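(* Let $d\ge 2$ and let $K\subset\mathbb{R}^d$ be a convex body such that a ball slides freely inside $K$ and $K$ slides freely inside a ball. Let $\varphi$ be an even Borel probability measure on $\mathbb{S}^{d-1}$ such that $$a\,\sigma\ge\varphi\ge b\,\sigma$$ with some positive constants $a,b$. Let $X_n$, $n\in\mathbb{N}$, be the stationary Poisson hyperplane processes with intensity $n$ and directional distribution $\varphi$ defined on a common probability space as in the context, and let $Z_K^{(n)}$ be the $K$-cell of $X_n$. Then $$\delta(K,Z_K^{(n)})\sim\left(\frac{\log n}{n}\right)^{2/(d+1)}\quad\text{almost surely, as } n\to\infty.$$
   Context: A convex body is a compact convex subset of $\mathbb{R}^d$ with nonempty interior. A ball is a Euclidean ball of positive radius. A convex body $M$ slides freely inside a convex body $K$ if $K$ is the union of all translates of $M$ that are contained in $K$. $\delta$ is the Hausdorff metric (Euclidean norm) and $\sigma$ is spherical Lebesgue measure on the unit sphere $\mathbb{S}^{d-1}$. Inequalities between measures are meant setwise. Let $\mathcal{H}^d$ be the space of hyperplanes in $\mathbb{R}^d$, $H(u,t)=\{x\in\mathbb{R}^d:\langle x,u\rangle=t\}$, and for $\gamma>0$ let $$\Theta_\gamma(A)=2\gamma\int_{\mathbb{S}^{d-1}}\int_0^\infty \mathbf{1}_A(H(u,t))\,dt\,\varphi(du),\qquad A\in\mathcal{B}(\mathcal{H}^d).$$ Let $\xi$ be a Poisson process on $[0,\infty)\times\mathcal{H}^d$ with intensity measure $\lambda\otimes\Theta_1$, where $\lambda$ is Lebesgue measure on $[0,\infty)$, and put $X_n:=\xi([0,n]\times\cdot)$;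 this is a stationary Poisson hyperplane process with intensity $n$, directional distribution $\varphi$ and intensity measure $\Theta_n$, identified with its support, a locally finite random set of hyperplanes. For a hyperplane $H$ with $H\cap K=\emptyset$, let $H^-_K$ be the closed halfspace bounded by $H$ that contains $K$. The $K$-cell of $X_n$ is the (almost surely bounded) random polytope $Z_K^{(n)}=\bigcap_{H\in X_n,\,H\cap K=\emptyset}H^-_K$. For real random variables $Y_n$ and nonnegative reals $f(n)$, "$Y_n\sim f(n)$ almost surely" means that there are (deterministic) constants $0<c\le C<\infty$ such that with probability one $cf(n)\le Y_n\le Cf(n)$ for all sufficiently large $n$. *)

theory Defs
  imports "HOL-Probability.Probability"
begin

section \<open>Convex bodies\<close>

definition convex_body :: "'a::euclidean_space set \<Rightarrow> bool" where
  "convex_body K \<longleftrightarrow> compact K \<and> convex K \<and> interior K \<noteq> {}"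

definition slides_freely_inside :: "'a::euclidean_space set \<Rightarrow> 'a set \<Rightarrow> bool" where
  "slides_freely_inside M K \<longleftrightarrow> K = \<Union>{(+) t ` M |t. (+) t ` M \<subseteq> K}"

text \<open>On nonempty bounded sets this is the Hausdorff metric; on unbounded sets the real-valued
  suprema carry no information.\<close>

definition hausdorff_distance :: "'a::euclidean_space set \<Rightarrow> 'a set \<Rightarrow> real" where
  "hausdorff_distance A B = max (SUP a\<in>A. infdist a B) (SUP b\<in>B. infdist b A)"

section \<open>Spherical Lebesgue measure\<close>

abbreviation sphere_borel :: "'a::euclidean_space measure" where
  "sphere_borel \<equiv> restrict_space borel (sphere 0 1)"

text \<open>The spherical measure of \<open>A\<close> is \<open>d\<close> times the volume of the cone over \<open>A\<close> inside the unit
  ball (the apex, a null set, is left out).\<close>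

definition sphere_lebesgue :: "'a::euclidean_space measure" where
  "sphere_lebesgue = measure_of (sphere 0 1) (sets sphere_borel)
     (\<lambda>A. of_nat DIM('a) * emeasure lborel {r *\<^sub>R u |r u. 0 < r \<and> r \<le> 1 \<and> u \<in> A})"

definition even_measure :: "'a::euclidean_space measure \<Rightarrow> bool" where
  "even_measure \<phi> \<longleftrightarrow> (\<forall>A\<in>sets \<phi>. emeasure \<phi> (uminus ` A) = emeasure \<phi> A)"

section \<open>The space of hyperplanes\<close>

definition hyperplane :: "'a::euclidean_space \<Rightarrow> real \<Rightarrow> 'a set" where
  "hyperplane u t = {x. x \<bullet> u = t}"

definition lower_halfspace :: "'a::euclidean_space \<Rightarrow> real \<Rightarrow> 'a set" where
  "lower_halfspace u t = {x. x \<bullet> u \<le> t}"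

definition hyperplanes :: "'a::euclidean_space set set" where
  "hyperplanes = {hyperplane u t |u t. u \<in> sphere 0 1}"

text \<open>The usual topology on the space of hyperplanes: the quotient topology induced by the
  parametrization \<open>(u, t) \<mapsto> hyperplane u t\<close> on \<open>sphere 0 1 \<times> UNIV\<close>.\<close>

definition hyperplane_topology :: "'a::euclidean_space set topology" where
  "hyperplane_topology = topology (\<lambda>U. U \<subseteq> hyperplanes \<and>
     openin (top_of_set (sphere 0 1 \<times> UNIV))
       {(u, t). u \<in> sphere 0 1 \<and> hyperplane u t \<in> U})"

definition borel_of_topology :: "'e topology \<Rightarrow> 'e measure" where
  "borel_of_topology T = sigma (topspace T) {U. openin T U}"

abbreviation hyperplane_borel :: "'a::euclidean_space set measure" where
  "hyperplane_borel \<equiv> borel_of_topology hyperplane_topology"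

definition hyperplane_intensity ::
    "'a::euclidean_space measure \<Rightarrow> real \<Rightarrow> 'a set measure" where
  "hyperplane_intensity \<phi> \<gamma> = measure_of hyperplanes (sets hyperplane_borel)
     (\<lambda>A. ennreal (2 * \<gamma>) *
        (\<integral>\<^sup>+u. (\<integral>\<^sup>+t\<in>{0..}. indicator A (hyperplane u t) \<partial>lborel) \<partial>\<phi>))"

section \<open>Poisson processes\<close>

text \<open>The topology \<open>T\<close> enters only through local finiteness: compact sets carry finitely many
  points.\<close>

definition locally_finite_counting_measure :: "'e topology \<Rightarrow> 'e measure \<Rightarrow> bool" where
  "locally_finite_counting_measure T \<eta> \<longleftrightarrow>
     (\<forall>A\<in>sets \<eta>. \<exists>k::enat. emeasure \<eta> A = ennreal_of_enat k) \<and>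
     (\<forall>C. compactin T C \<longrightarrow> emeasure \<eta> C < \<infinity>)"

definition poisson_process ::
    "'w measure \<Rightarrow> 'e topology \<Rightarrow> 'e measure \<Rightarrow> ('w \<Rightarrow> 'e measure) \<Rightarrow> bool" where
  "poisson_process P T \<Lambda> \<xi> \<longleftrightarrow>
     (\<forall>\<omega>\<in>space P. sets (\<xi> \<omega>) = sets \<Lambda> \<and> locally_finite_counting_measure T (\<xi> \<omega>)) \<and>
     (\<forall>A\<in>sets \<Lambda>. (\<lambda>\<omega>. emeasure (\<xi> \<omega>) A) \<in> borel_measurable P) \<and>
     (\<forall>A\<in>sets \<Lambda>. emeasure \<Lambda> A < \<infinity> \<longrightarrow>
        (\<forall>k::nat. measure P {\<omega>\<in>space P. emeasure (\<xi> \<omega>) A = of_nat k} =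
           exp (- measure \<Lambda> A) * measure \<Lambda> A ^ k / fact k)) \<and>
     (\<forall>(A::nat \<Rightarrow> 'e set) m. A ` {..<m} \<subseteq> sets \<Lambda> \<and> disjoint_family_on A {..<m} \<longrightarrow>
        prob_space.indep_vars P (\<lambda>_. borel) (\<lambda>i \<omega>. emeasure (\<xi> \<omega>) (A i)) {..<m})"

definition poisson_hyperplane_driver ::
    "'w measure \<Rightarrow> 'a::euclidean_space measure \<Rightarrow> ('w \<Rightarrow> (real \<times> 'a set) measure) \<Rightarrow> bool" where
  "poisson_hyperplane_driver P \<phi> \<xi> \<longleftrightarrow>
     poisson_process P (prod_topology (top_of_set {0..}) hyperplane_topology)
       (restrict_space lborel {0..} \<Otimes>\<^sub>M hyperplane_intensity \<phi> 1) \<xi>"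

definition hyperplane_process ::
    "('w \<Rightarrow> (real \<times> 'a::euclidean_space set) measure) \<Rightarrow> nat \<Rightarrow> 'w \<Rightarrow> 'a set measure" where
  "hyperplane_process \<xi> n \<omega> = measure_of hyperplanes (sets hyperplane_borel)
     (\<lambda>A. emeasure (\<xi> \<omega>) ({0..real n} \<times> A))"

definition measure_support :: "'e topology \<Rightarrow> 'e measure \<Rightarrow> 'e set" where
  "measure_support T \<eta> = {x \<in> topspace T. \<forall>U. openin T U \<and> x \<in> U \<longrightarrow> emeasure \<eta> U > 0}"

section \<open>The K-cell\<close>

text \<open>If \<open>K\<close> is nonempty and disjoint from a hyperplane, exactly one of its two closed halfspaces
  contains \<open>K\<close>; both orientations of the unit normal are available.\<close>

definition K_cell :: "'a::euclidean_space set \<Rightarrow> 'a set set \<Rightarrow> 'a set" where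
  "K_cell K X = \<Inter>{lower_halfspace u t |u t. u \<in> sphere 0 1 \<and> hyperplane u t \<in> X \<and>
     hyperplane u t \<inter> K = {} \<and> K \<subseteq> lower_halfspace u t}"

definition process_cell ::
    "'a::euclidean_space set \<Rightarrow> ('w \<Rightarrow> (real \<times> 'a set) measure) \<Rightarrow> nat \<Rightarrow> 'w \<Rightarrow> 'a set" where
  "process_cell K \<xi> n \<omega> =
     K_cell K (measure_support hyperplane_topology (hyperplane_process \<xi> n \<omega>))"

section \<open>Almost sure order of magnitude\<close>

definition almost_surely_of_order ::
    "'w measure \<Rightarrow> (nat \<Rightarrow> 'w \<Rightarrow> real) \<Rightarrow> (nat \<Rightarrow> real) \<Rightarrow> bool" where
  "almost_surely_of_order P Y f \<longleftrightarrow>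
     (\<exists>c C. 0 < c \<and> c \<le> C \<and>
        (AE \<omega> in P. \<forall>\<^sub>F n in sequentially. c * f n \<le> Y n \<omega> \<and> Y n \<omega> \<le> C * f n))"

section \<open>Well-definedness of the measures above\<close>

lemma openin_hyperplane_topology:
  "openin hyperplane_topology U \<longleftrightarrow> U \<subseteq> (hyperplanes :: 'a::euclidean_space set set) \<and>
     openin (top_of_set (sphere 0 1 \<times> UNIV)) {(u, t). u \<in> sphere 0 1 \<and> hyperplane u t \<in> U}"
proof -
  let ?pre = "\<lambda>U. {(u::'a, t). u \<in> sphere 0 1 \<and> hyperplane u t \<in> U}"
  have Int: "?pre (S \<inter> T) = ?pre S \<inter> ?pre T" for S T by auto
  have Un: "?pre (\<Union>\<K>) = \<Union>(?pre ` \<K>)" for \<K> by auto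
  have "istopology (\<lambda>U. U \<subseteq> hyperplanes \<and> openin (top_of_set (sphere 0 1 \<times> UNIV)) (?pre U))"
    unfolding istopology_def Int Un by (auto intro!: openin_Int openin_Union)
  then show ?thesis
    unfolding hyperplane_topology_def by simp
qed

lemma topspace_hyperplane_topology: "topspace hyperplane_topology = hyperplanes"
proof -
  have "{(u::'a, t). u \<in> sphere 0 1 \<and> hyperplane u t \<in> hyperplanes} = sphere 0 1 \<times> UNIV"
    by (auto simp: hyperplanes_def)
  then have "openin hyperplane_topology (hyperplanes :: 'a set set)"
    unfolding openin_hyperplane_topology by simp
  then show ?thesis
    unfolding topspace_def using openin_hyperplane_topology by blast
qed

lemma space_hyperplane_borel: "space hyperplane_borel = hyperplanes"
  and sets_hyperplane_borel:
    "sets hyperplane_borel = sigma_sets hyperplanes {U. openin hyperplane_topology U}"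
  unfolding borel_of_topology_def topspace_hyperplane_topology
  using openin_hyperplane_topology by (auto intro!: space_measure_of sets_measure_of)

lemma measurable_hyperplane:
  "(\<lambda>(u::'a::euclidean_space, t). hyperplane u t)
     \<in> (sphere_borel \<Otimes>\<^sub>M borel) \<rightarrow>\<^sub>M hyperplane_borel"
proof (rule measurable_sigma_sets[OF sets_hyperplane_borel])
  show "{U. openin hyperplane_topology U} \<subseteq> Pow hyperplanes"
    using openin_hyperplane_topology by auto
  have sp: "space (sphere_borel \<Otimes>\<^sub>M (borel :: real measure)) = (sphere 0 1 :: 'a set) \<times> UNIV"
    by (simp add: space_pair_measure space_restrict_space)
  show "(\<lambda>(u::'a, t). hyperplane u t) \<in> space (sphere_borel \<Otimes>\<^sub>M borel) \<rightarrow> hyperplanes"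
    unfolding sp hyperplanes_def by auto
  fix U :: "'a set set" assume "U \<in> {U. openin hyperplane_topology U}"
  then have "openin (top_of_set (sphere 0 1 \<times> UNIV))
      {(u, t). u \<in> sphere 0 1 \<and> hyperplane u t \<in> U}"
    by (simp add: openin_hyperplane_topology)
  then obtain V where V: "open V"
    "{(u, t). u \<in> sphere 0 1 \<and> hyperplane u t \<in> U} = (sphere 0 1 \<times> UNIV) \<inter> V"
    unfolding openin_open by blast
  have incl: "(\<lambda>x. x) \<in> (sphere_borel :: 'a measure) \<rightarrow>\<^sub>M borel"
    by (rule measurable_restrict_space1) simp
  have "(\<lambda>p. (fst p, snd p)) \<in> (sphere_borel \<Otimes>\<^sub>M (borel :: real measure)) \<rightarrow>\<^sub>M
      (borel :: ('a \<times> real) measure)"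
    unfolding borel_prod[symmetric]
    by (intro measurable_Pair measurable_snd measurable_compose[OF measurable_fst incl])
  from measurable_sets[OF this borel_open[OF V(1)]]
  have "(sphere 0 1 \<times> UNIV) \<inter> V \<in> sets (sphere_borel \<Otimes>\<^sub>M borel)"
    by (simp add: sp Int_commute)
  moreover have "(\<lambda>(u, t). hyperplane u t) -` U \<inter> space (sphere_borel \<Otimes>\<^sub>M borel) =
      (sphere 0 1 \<times> UNIV) \<inter> V"
    unfolding V(2)[symmetric] sp by auto
  ultimately show "(\<lambda>(u, t). hyperplane u t) -` U \<inter> space (sphere_borel \<Otimes>\<^sub>M borel)
      \<in> sets (sphere_borel \<Otimes>\<^sub>M borel)"
    by simp
qed

lemma sets_hyperplane_intensity: "sets (hyperplane_intensity \<phi> \<gamma>) = sets hyperplane_borel"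
  unfolding hyperplane_intensity_def space_hyperplane_borel[symmetric] by simp

lemma emeasure_hyperplane_intensity:
  assumes phi: "sets \<phi> = sets sphere_borel" and A: "A \<in> sets hyperplane_borel"
  shows "emeasure (hyperplane_intensity \<phi> \<gamma>) A = ennreal (2 * \<gamma>) *
      (\<integral>\<^sup>+u. (\<integral>\<^sup>+t\<in>{0..}. indicator A (hyperplane u t) \<partial>lborel) \<partial>\<phi>)"
proof -
  have m2: "(\<lambda>(u, t). indicator B (hyperplane u t) * indicator {0..} t :: ennreal)
      \<in> borel_measurable (\<phi> \<Otimes>\<^sub>M lborel)" if "B \<in> sets hyperplane_borel" for B :: "'a set set"
  proof -
    have s: "sets (\<phi> \<Otimes>\<^sub>M lborel) = sets (sphere_borel \<Otimes>\<^sub>M (borel :: real measure))"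
      by (intro sets_pair_measure_cong phi) simp
    have "(\<lambda>p. indicator B (case p of (u, t) \<Rightarrow> hyperplane u t) :: ennreal)
        \<in> borel_measurable (\<phi> \<Otimes>\<^sub>M lborel)"
      unfolding measurable_cong_sets[OF s refl]
      by (rule measurable_compose[OF measurable_hyperplane]) (use that in simp)
    then have "(\<lambda>p. indicator B (case p of (u, t) \<Rightarrow> hyperplane u t) * indicator {0..} (snd p) :: ennreal)
        \<in> borel_measurable (\<phi> \<Otimes>\<^sub>M lborel)"
      by (intro borel_measurable_times_ennreal) auto
    then show ?thesis by (simp add: case_prod_beta')
  qed
  have m1: "(\<lambda>u. \<integral>\<^sup>+t\<in>{0..}. indicator B (hyperplane u t) \<partial>lborel) \<in> borel_measurable \<phi>"
    if "B \<in> sets hyperplane_borel" for B :: "'a set set"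
    using lborel.borel_measurable_nn_integral[OF m2[OF that]] by simp
  have m0: "(\<lambda>t. indicator B (hyperplane u t) * indicator {0..} t :: ennreal)
      \<in> borel_measurable lborel" if "B \<in> sets hyperplane_borel" "u \<in> space \<phi>"
    for B :: "'a set set" and u
    using measurable_Pair2[OF m2[OF that(1)] that(2)] by simp
  let ?f = "\<lambda>A. ennreal (2 * \<gamma>) *
      (\<integral>\<^sup>+u. (\<integral>\<^sup>+t\<in>{0..}. indicator A (hyperplane u t) \<partial>lborel) \<partial>\<phi>)"
  have ca: "countably_additive (sets hyperplane_borel) ?f"
    unfolding countably_additive_def
  proof (intro allI impI)
    fix B :: "nat \<Rightarrow> 'a set set"
    assume B: "range B \<subseteq> sets hyperplane_borel" "disjoint_family B"
    have Bi: "B i \<in> sets hyperplane_borel" for i using B(1) by auto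
    have "(\<Sum>i. ?f (B i)) = ennreal (2 * \<gamma>) *
        (\<integral>\<^sup>+u. (\<Sum>i. \<integral>\<^sup>+t\<in>{0..}. indicator (B i) (hyperplane u t) \<partial>lborel) \<partial>\<phi>)"
      by (simp add: nn_integral_suminf m1 Bi)
    also have "(\<integral>\<^sup>+u. (\<Sum>i. \<integral>\<^sup>+t\<in>{0..}. indicator (B i) (hyperplane u t) \<partial>lborel) \<partial>\<phi>) =
        (\<integral>\<^sup>+u. (\<integral>\<^sup>+t\<in>{0..}. indicator (\<Union>i. B i) (hyperplane u t) \<partial>lborel) \<partial>\<phi>)"
    proof (rule nn_integral_cong)
      fix u assume u: "u \<in> space \<phi>"
      have "(\<Sum>i. \<integral>\<^sup>+t\<in>{0..}. indicator (B i) (hyperplane u t) \<partial>lborel) =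
          (\<integral>\<^sup>+t. (\<Sum>i. indicator (B i) (hyperplane u t) * indicator {0..} t) \<partial>lborel)"
        by (rule nn_integral_suminf[symmetric]) (rule m0[OF Bi u])
      also have "\<dots> = (\<integral>\<^sup>+t\<in>{0..}. indicator (\<Union>i. B i) (hyperplane u t) \<partial>lborel)"
        by (simp add: suminf_indicator[OF B(2)])
      finally show "(\<Sum>i. \<integral>\<^sup>+t\<in>{0..}. indicator (B i) (hyperplane u t) \<partial>lborel) =
          (\<integral>\<^sup>+t\<in>{0..}. indicator (\<Union>i. B i) (hyperplane u t) \<partial>lborel)" .
    qed
    finally show "(\<Sum>i. ?f (B i)) = ?f (\<Union>i. B i)" .
  qed
  show ?thesis
    unfolding hyperplane_intensity_def
    by (rule emeasure_measure_of_sigma[OF _ _ ca A])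
      (use sets.sigma_algebra_axioms[of "hyperplane_borel :: 'a set measure"]
        in \<open>auto simp: space_hyperplane_borel positive_def\<close>)
qed

lemma emeasure_hyperplane_process:
  assumes sets: "sets (\<xi> \<omega>) = sets (restrict_space lborel {0..} \<Otimes>\<^sub>M hyperplane_intensity \<phi> 1)"
    and A: "A \<in> sets hyperplane_borel"
  shows "emeasure (hyperplane_process \<xi> n \<omega>) A = emeasure (\<xi> \<omega>) ({0..real n} \<times> A)"
proof -
  have B: "{0..real n} \<times> B \<in> sets (\<xi> \<omega>)" if "B \<in> sets hyperplane_borel" for B
    unfolding sets using that
    by (intro pair_measureI) (auto simp: sets_hyperplane_intensity sets_restrict_space_iff)
  have ca: "countably_additive (sets hyperplane_borel) (\<lambda>A. emeasure (\<xi> \<omega>) ({0..real n} \<times> A))"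
    unfolding countably_additive_def
  proof (intro allI impI)
    fix F :: "nat \<Rightarrow> 'a set set"
    assume F: "range F \<subseteq> sets hyperplane_borel" "disjoint_family F"
    have "(\<Sum>i. emeasure (\<xi> \<omega>) ({0..real n} \<times> F i)) = emeasure (\<xi> \<omega>) (\<Union>i. {0..real n} \<times> F i)"
      by (rule suminf_emeasure) (use F B in \<open>auto simp: disjoint_family_on_def\<close>)
    also have "(\<Union>i. {0..real n} \<times> F i) = {0..real n} \<times> (\<Union>i. F i)" by auto
    finally show "(\<Sum>i. emeasure (\<xi> \<omega>) ({0..real n} \<times> F i)) =
        emeasure (\<xi> \<omega>) ({0..real n} \<times> (\<Union>i. F i))" .
  qed
  show ?thesis
    unfolding hyperplane_process_def
    by (rule emeasure_measure_of_sigma[OF _ _ ca A])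
      (use sets.sigma_algebra_axioms[of "hyperplane_borel :: 'a set measure"]
        in \<open>auto simp: space_hyperplane_borel positive_def\<close>)
qed

lemma sphere_cone_eq:
  fixes A :: "'a::euclidean_space set"
  assumes "A \<subseteq> sphere 0 1"
  shows "{r *\<^sub>R u |r u. 0 < r \<and> r \<le> 1 \<and> u \<in> A} = {x. 0 < norm x \<and> norm x \<le> 1 \<and> sgn x \<in> A}"
    (is "?L = ?R")
proof
  show "?L \<subseteq> ?R" using assms by (auto simp: sgn_div_norm subset_iff)
  show "?R \<subseteq> ?L"
  proof
    fix x assume "x \<in> ?R"
    moreover from this have "x = norm x *\<^sub>R sgn x" by (simp add: sgn_div_norm)
    ultimately show "x \<in> ?L" by blast
  qed
qed

lemma emeasure_sphere_lebesgue:
  fixes A :: "'a::euclidean_space set"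
  assumes A: "A \<in> sets sphere_borel"
  shows "emeasure sphere_lebesgue A =
    of_nat DIM('a) * emeasure lborel {r *\<^sub>R u |r u. 0 < r \<and> r \<le> 1 \<and> u \<in> A}"
proof -
  define cone :: "'a set \<Rightarrow> 'a set"
    where "cone A = {r *\<^sub>R u |r u. 0 < r \<and> r \<le> 1 \<and> u \<in> A}" for A
  have S: "B \<subseteq> sphere 0 1 \<and> B \<in> sets borel" if "B \<in> sets sphere_borel" for B :: "'a set"
    using that by (simp add: sets_restrict_space_iff)
  have cone: "cone B = {x. 0 < norm x \<and> norm x \<le> 1 \<and> sgn x \<in> B}" if "B \<in> sets sphere_borel" for B
    unfolding cone_def using S[OF that] sphere_cone_eq by blast
  have meas: "cone B \<in> sets lborel" if "B \<in> sets sphere_borel" for B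
  proof -
    have "(sgn :: 'a \<Rightarrow> 'a) \<in> borel_measurable borel"
      unfolding sgn_div_norm[abs_def] by measurable
    then have "{x. sgn x \<in> B} \<in> sets borel"
      using measurable_sets[of sgn borel borel B] S[OF that] by (simp add: vimage_def)
    moreover have "{x::'a. 0 < norm x \<and> norm x \<le> 1} \<in> sets borel" by measurable
    ultimately have "{x::'a. 0 < norm x \<and> norm x \<le> 1} \<inter> {x. sgn x \<in> B} \<in> sets borel" by blast
    then show ?thesis unfolding cone[OF that] by (simp add: Collect_conj_eq Int_assoc)
  qed
  have ca: "countably_additive (sets sphere_borel)
      (\<lambda>A. of_nat DIM('a) * emeasure lborel (cone A))"
    unfolding countably_additive_def
  proof (intro allI impI)
    fix F :: "nat \<Rightarrow> 'a set"
    assume F: "range F \<subseteq> sets sphere_borel" "disjoint_family F" "\<Union> (range F) \<in> sets sphere_borel"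
    have Fi: "F i \<in> sets sphere_borel" for i using F(1) by auto
    have "(\<Sum>i. emeasure lborel (cone (F i))) = emeasure lborel (\<Union>i. cone (F i))"
    proof (rule suminf_emeasure)
      show "disjoint_family (\<lambda>i. cone (F i))"
        using F(2) by (auto simp: disjoint_family_on_def cone[OF Fi])
    qed (use meas[OF Fi] in auto)
    also have "(\<Union>i. cone (F i)) = cone (\<Union>i. F i)"
      unfolding cone_def by blast
    finally show "(\<Sum>i. of_nat DIM('a) * emeasure lborel (cone (F i))) =
        of_nat DIM('a) * emeasure lborel (cone (\<Union>i. F i))"
      by simp
  qed
  have "sigma_algebra (sphere 0 1) (sets (sphere_borel :: 'a measure))"
    using sets.sigma_algebra_axioms[of "sphere_borel :: 'a measure"]
    by (simp add: space_restrict_space)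
  moreover have "positive (sets sphere_borel) (\<lambda>A. of_nat DIM('a) * emeasure lborel (cone A))"
    by (auto simp: positive_def cone_def)
  ultimately show ?thesis
    unfolding sphere_lebesgue_def cone_def[symmetric]
    by (rule emeasure_measure_of_sigma[OF _ _ ca A])
qed

end

theory Submission
  imports Defs
begin

text \<open>A point \<open>x\<close> lies in the cell at time \<open>n\<close> iff the Poisson process has no point in
  \<open>[0, n] \<times> S\<^sub>x\<close>, where \<open>S\<^sub>x\<close> is the set of hyperplanes strictly separating \<open>x\<close> from \<open>K\<close>. If
  \<open>x\<close> has small distance \<open>e\<close> from \<open>K\<close>, the sliding balls confine the normals of these hyperplanes
  to a spherical cap of radius of order \<open>\<surd>e\<close>, and force a smaller such cap to occur; over each
  direction the admissible offsets form an interval of length of order \<open>e\<close>. So \<open>S\<^sub>x\<close> has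
  intensity of order \<open>e powr ((d + 1) / 2)\<close>, and for \<open>e = C * (ln n / n) powr (2 / (d + 1))\<close> the
  probability that \<open>x\<close> is in the cell is a power of \<open>n\<close> whose exponent is controlled by \<open>C\<close>.
  For large \<open>C\<close> a union bound over a net of polynomial size and Borel--Cantelli give the upper
  bound. For small \<open>C\<close> one finds a positive power of \<open>n\<close> many points whose sets \<open>S\<^sub>x\<close> are
  disjoint, so that independence and Borel--Cantelli give the lower bound.\<close>

section \<open>Hyperplanes and the cell\<close>

text \<open>The cell contains \<open>K\<close>, so its Hausdorff distance from \<open>K\<close> is
  the supremum of \<open>infdist x K\<close> over the cell, and both bounds concern which points the
  cell contains. For the upper bound the cell has uncountably many points and no a priori bound on
  its size. The first obstacle explains the slack \<open>\<eta>\<close> in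
  \<open>separating\<close>: if \<open>x\<close> is in the cell and
  \<open>dist x y \<le> \<eta>\<close>, then no process point lies over
  \<open>separating K y \<eta>\<close>, and for \<open>\<eta> = e / 4\<close> this smaller set still
  has intensity of order \<open>e powr ((d + 1) / 2)\<close>, namely a length of order
  \<open>e\<close> times a cap of measure of order \<open>sqrt e ^ (d - 1)\<close>. The second is
  met by convexity: a far point of the cell forces one at distance exactly \<open>5 / 4 * e\<close>,
  so a net of a fixed neighbourhood of \<open>K\<close> is enough. For the lower bound, sets
  \<open>S_x\<close> belonging to outer normals further apart than two cap radii are disjoint. The
  cap radius is of order \<open>(ln n / n) powr (1 / (d + 1))\<close>, so a small power of
  \<open>n\<close> many normals fit on a single arc. In both bounds the exceptional events have
  summable probabilities, and the first Borel--Cantelli lemma applies.\<close>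

definition hyperplanes_of :: "('a::euclidean_space \<times> real) set \<Rightarrow> 'a set set" where
  "hyperplanes_of W = {hyperplane u t |u t. u \<in> sphere 0 1 \<and> (u, t) \<in> W}"

text \<open>Here \<open>u\<close> ranges over all vectors, so that the set is open in the product
  space when \<open>K\<close> is compact; unit normals are imposed only by
  \<open>hyperplanes_of\<close>.\<close>

definition separating :: "'a::euclidean_space set \<Rightarrow> 'a \<Rightarrow> real \<Rightarrow> ('a \<times> real) set" where
  "separating K y \<eta> = {(u, t). (\<forall>k\<in>K. k \<bullet> u < t) \<and> t < y \<bullet> u - \<eta>}"

text \<open>Both \<open>t *\<^sub>R u\<close> and its shift by the component of \<open>u'\<close>
  orthogonal to \<open>u\<close> lie in the common hyperplane. Hence this component is also
  orthogonal to \<open>u'\<close>, which gives \<open>(u' \<bullet> u)\<^sup>2 = 1\<close>.\<close>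

lemma hyperplane_eqD:
  fixes u u' :: "'a::euclidean_space"
  assumes eq: "hyperplane u t = hyperplane u' t'" and u: "norm u = 1" and u': "norm u' = 1"
  shows "(u', t') = (u, t) \<or> (u', t') = (- u, - t)"
proof -
  have uu: "u \<bullet> u = 1" "u' \<bullet> u' = 1"
    using u u' by (simp_all add: dot_square_norm)
  let ?w = "u' - (u' \<bullet> u) *\<^sub>R u"
  have "t *\<^sub>R u \<in> hyperplane u t" "t *\<^sub>R u + ?w \<in> hyperplane u t"
    using uu by (simp_all add: hyperplane_def inner_simps)
  then have 1: "(t *\<^sub>R u) \<bullet> u' = t'" and 2: "(t *\<^sub>R u + ?w) \<bullet> u' = t'"
    unfolding eq by (simp_all add: hyperplane_def)
  from 1 2 have "?w \<bullet> u' = 0"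
    by (simp add: inner_add_left)
  then have "(u' \<bullet> u)\<^sup>2 = 1"
    using uu by (simp add: inner_simps power2_eq_square inner_commute)
  then have "u' \<bullet> u = 1 \<or> u' \<bullet> u = - 1"
    by (simp add: power2_eq_1_iff)
  then show ?thesis
  proof
    assume *: "u' \<bullet> u = 1"
    then have "(u' - u) \<bullet> (u' - u) = 0"
      using uu by (simp add: inner_simps inner_commute)
    then have "u' = u" by simp
    with 1 uu show ?thesis by simp
  next
    assume *: "u' \<bullet> u = - 1"
    then have "(u' + u) \<bullet> (u' + u) = 0"
      using uu by (simp add: inner_simps inner_commute)
    then have "u' = - u" by (simp add: eq_neg_iff_add_eq_0)
    with 1 uu show ?thesis by simp
  qed
qed

lemma hyperplane_minus: "hyperplane (- u) (- t) = hyperplane u t"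
  by (simp add: hyperplane_def)

lemma hyperplane_mem_hyperplanes_of:
  assumes "u \<in> sphere 0 1"
  shows "hyperplane u t \<in> hyperplanes_of W \<longleftrightarrow> (u, t) \<in> W \<or> (- u, - t) \<in> W"
proof
  assume "hyperplane u t \<in> hyperplanes_of W"
  then obtain u' t' where "hyperplane u t = hyperplane u' t'" "u' \<in> sphere 0 1" "(u', t') \<in> W"
    unfolding hyperplanes_of_def by blast
  with assms show "(u, t) \<in> W \<or> (- u, - t) \<in> W"
    using hyperplane_eqD[of u t u' t'] by auto
next
  assume "(u, t) \<in> W \<or> (- u, - t) \<in> W"
  moreover have "- u \<in> sphere 0 1" using assms by simp
  ultimately show "hyperplane u t \<in> hyperplanes_of W"
    using assms unfolding hyperplanes_of_def by (metis (mono_tags, lifting) hyperplane_minus mem_Collect_eq)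
qed

text \<open>A hyperplane has two parameters, so the preimage in the parameter space is the union of
  \<open>W\<close> and its reflection, intersected with
  \<open>sphere 0 1 \<times> UNIV\<close>.\<close>

lemma openin_hyperplanes_of:
  assumes "open W"
  shows "openin hyperplane_topology (hyperplanes_of W)"
  unfolding openin_hyperplane_topology
proof
  show "hyperplanes_of W \<subseteq> hyperplanes"
    unfolding hyperplanes_of_def hyperplanes_def by blast
  have "open ((\<lambda>p. - p) -` W)"
    by (intro open_vimage assms continuous_intros)
  with assms have "open (W \<union> (\<lambda>p. - p) -` W)" by blast
  moreover have "{(u, t). u \<in> sphere 0 1 \<and> hyperplane u t \<in> hyperplanes_of W} =
      (sphere 0 1 \<times> UNIV) \<inter> (W \<union> (\<lambda>p. - p) -` W)"
    using hyperplane_mem_hyperplanes_of by fastforce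
  ultimately show "openin (top_of_set (sphere 0 1 \<times> UNIV))
      {(u, t). u \<in> sphere 0 1 \<and> hyperplane u t \<in> hyperplanes_of W}"
    unfolding openin_open by blast
qed

lemma sets_hyperplanes_of:
  assumes "open W"
  shows "hyperplanes_of W \<in> sets hyperplane_borel"
  unfolding sets_hyperplane_borel using openin_hyperplanes_of[OF assms] by blast

text \<open>The pairs with \<open>t \<le> k \<bullet> u\<close> for some \<open>k\<close> in
  \<open>K\<close> form the projection of a closed set along the compact factor \<open>K\<close>,
  hence a closed set.\<close>

lemma open_separating:
  assumes "compact K"
  shows "open (separating K y \<eta>)"
proof -
  have "closed {z::'a \<times> 'a \<times> real. snd (snd z) \<le> fst z \<bullet> fst (snd z)}"
    by (intro closed_Collect_le continuous_intros)
  then have "closed {p. \<exists>k. k \<in> K \<and> (k, p) \<in> {z. snd (snd z) \<le> fst z \<bullet> fst (snd z)}}"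
    using closed_compact_projection[OF assms] by blast
  moreover have "closed {p. y \<bullet> fst p - \<eta> \<le> snd p}"
    by (intro closed_Collect_le continuous_intros)
  ultimately have "open (- ({p. \<exists>k. k \<in> K \<and> (k, p) \<in> {z. snd (snd z) \<le> fst z \<bullet> fst (snd z)}} \<union>
      {p. y \<bullet> fst p - \<eta> \<le> snd p}))"
    by (intro open_Compl closed_Un)
  also have "\<dots> = separating K y \<eta>"
    by (auto simp: separating_def not_le)
  finally show ?thesis .
qed

text \<open>The hyperplane topology is a quotient of a second countable space, hence hereditarily Lindeloef.\<close>

lemma emeasure_eq_0_off_support:
  assumes sets: "sets \<eta> = sets hyperplane_borel"
    and A: "openin hyperplane_topology A"
    and disj: "A \<inter> measure_support hyperplane_topology \<eta> = {}"
  shows "emeasure \<eta> A = 0"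
proof -
  have AH: "A \<subseteq> hyperplanes"
    using A openin_hyperplane_topology by blast
  define \<U> where "\<U> = {U. openin hyperplane_topology U \<and> emeasure \<eta> U = 0}"
  define pre :: "'a set set \<Rightarrow> ('a \<times> real) set"
    where "pre U = {(u, t). u \<in> sphere 0 1 \<and> hyperplane u t \<in> U}" for U
  have "\<exists>\<U>'\<subseteq>pre ` \<U>. countable \<U>' \<and> \<Union>\<U>' = \<Union>(pre ` \<U>)"
  proof (rule Lindelof_openin)
    fix S assume "S \<in> pre ` \<U>"
    then show "openin (top_of_set (sphere 0 1 \<times> UNIV)) S"
      using openin_hyperplane_topology unfolding \<U>_def pre_def by auto
  qed blast
  then obtain \<V> where \<V>: "\<V> \<subseteq> pre ` \<U>" "countable \<V>" "\<Union>\<V> = \<Union>(pre ` \<U>)" by blast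
  obtain \<W> where \<W>: "\<W> \<subseteq> \<U>" "countable \<W>" "\<V> = pre ` \<W>"
    using countable_subset_image \<V>(1,2) by (metis (no_types, lifting))
  have Uset: "U \<in> sets \<eta>" if "U \<in> \<U>" for U
    using that unfolding \<U>_def sets sets_hyperplane_borel by blast
  have "A \<subseteq> \<Union>\<W>"
  proof
    fix H assume H: "H \<in> A"
    then have "H \<in> topspace hyperplane_topology" "H \<notin> measure_support hyperplane_topology \<eta>"
      using AH disj by (auto simp: topspace_hyperplane_topology)
    then obtain U where "openin hyperplane_topology U" "H \<in> U" "emeasure \<eta> U = 0"
      unfolding measure_support_def by auto
    then have U: "U \<in> \<U>" "H \<in> U" by (auto simp: \<U>_def)
    obtain u t where ut: "H = hyperplane u t" "u \<in> sphere 0 1"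
      using H AH unfolding hyperplanes_def by blast
    have "(u, t) \<in> pre U" using U ut by (simp add: pre_def)
    then have "(u, t) \<in> \<Union>(pre ` \<W>)" using U \<V>(3) \<W>(3) by blast
    then show "H \<in> \<Union>\<W>" using ut by (auto simp: pre_def)
  qed
  moreover have "\<Union>\<W> \<in> null_sets \<eta>"
  proof -
    have "(\<Union>U\<in>\<W>. U) \<in> null_sets \<eta>"
      using \<W>(1,2) Uset by (intro null_sets_UN') (auto simp: \<U>_def)
    then show ?thesis by simp
  qed
  ultimately show ?thesis
    by (metis emeasure_eq_0 null_setsD1 null_setsD2)
qed

text \<open>The cell sees only the support of the process, whereas probabilities are known for
  counts. For an open set, having measure zero and missing the support are the same, and a point is
  cut off from the cell exactly by a supported hyperplane that separates it strictly from
  \<open>K\<close>.\<close>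

lemma mem_process_cell_iff:
  assumes sets: "sets (\<xi> \<omega>) = sets (restrict_space lborel {0..} \<Otimes>\<^sub>M hyperplane_intensity \<phi> 1)"
    and K: "compact K"
  shows "x \<in> process_cell K \<xi> n \<omega> \<longleftrightarrow>
    emeasure (\<xi> \<omega>) ({0..real n} \<times> hyperplanes_of (separating K x 0)) = 0"
proof -
  let ?\<eta> = "hyperplane_process \<xi> n \<omega>"
  let ?A = "hyperplanes_of (separating K x 0)"
  let ?S = "measure_support hyperplane_topology ?\<eta>"
  have op: "openin hyperplane_topology ?A"
    by (intro openin_hyperplanes_of open_separating K)
  have s: "sets ?\<eta> = sets hyperplane_borel"
    unfolding hyperplane_process_def space_hyperplane_borel[symmetric] by simp
  have "emeasure ?\<eta> ?A = 0 \<longleftrightarrow> ?A \<inter> ?S = {}"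
  proof
    show "?A \<inter> ?S = {}" if "emeasure ?\<eta> ?A = 0"
      using that op unfolding measure_support_def by fastforce
  qed (rule emeasure_eq_0_off_support[OF s op])
  moreover have "emeasure ?\<eta> ?A = emeasure (\<xi> \<omega>) ({0..real n} \<times> ?A)"
    by (rule emeasure_hyperplane_process[where \<phi>=\<phi> and \<xi>=\<xi> and \<omega>=\<omega>, OF sets])
       (intro sets_hyperplanes_of open_separating K)
  moreover have "x \<in> process_cell K \<xi> n \<omega> \<longleftrightarrow> ?A \<inter> ?S = {}"
  proof -
    have "hyperplane u t \<inter> K = {} \<and> K \<subseteq> lower_halfspace u t \<longleftrightarrow> (\<forall>k\<in>K. k \<bullet> u < t)" for u t
      by (auto simp: hyperplane_def lower_halfspace_def less_le)
    then have cell: "process_cell K \<xi> n \<omega> = \<Inter>{lower_halfspace u t |u t. u \<in> sphere 0 1 \<and>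
        hyperplane u t \<in> ?S \<and> (\<forall>k\<in>K. k \<bullet> u < t)}"
      unfolding process_cell_def K_cell_def by simp
    have A: "H \<in> ?A \<longleftrightarrow>
        (\<exists>u t. H = hyperplane u t \<and> u \<in> sphere 0 1 \<and> (\<forall>k\<in>K. k \<bullet> u < t) \<and> t < x \<bullet> u)" for H
      unfolding hyperplanes_of_def separating_def mem_Collect_eq prod.case diff_zero ..
    show ?thesis
    proof
      assume x: "x \<in> process_cell K \<xi> n \<omega>"
      show "?A \<inter> ?S = {}"
      proof (rule equals0I)
        fix H assume H: "H \<in> ?A \<inter> ?S"
        obtain u t where ut: "H = hyperplane u t" "u \<in> sphere 0 1" "\<forall>k\<in>K. k \<bullet> u < t" "t < x \<bullet> u"
          using iffD1[OF A IntD1[OF H]] by (elim exE conjE)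
        have "hyperplane u t \<in> ?S"
          using IntD2[OF H] unfolding ut(1) .
        then have "lower_halfspace u t \<in> {lower_halfspace u t |u t. u \<in> sphere 0 1 \<and>
            hyperplane u t \<in> ?S \<and> (\<forall>k\<in>K. k \<bullet> u < t)}"
          using ut(2,3) by blast
        with x have "x \<in> lower_halfspace u t"
          unfolding cell by (rule InterD)
        with ut(4) show False by (simp add: lower_halfspace_def)
      qed
    next
      assume disj: "?A \<inter> ?S = {}"
      show "x \<in> process_cell K \<xi> n \<omega>"
        unfolding cell
      proof (rule InterI)
        fix h assume "h \<in> {lower_halfspace u t |u t. u \<in> sphere 0 1 \<and>
          hyperplane u t \<in> ?S \<and> (\<forall>k\<in>K. k \<bullet> u < t)}"
        then obtain u t where h: "h = lower_halfspace u t" and ut: "u \<in> sphere 0 1"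
          "hyperplane u t \<in> ?S" "\<forall>k\<in>K. k \<bullet> u < t" by blast
        have "\<not> t < x \<bullet> u"
        proof
          assume "t < x \<bullet> u"
          with ut have "hyperplane u t \<in> ?A"
            unfolding A by (intro exI[of _ u] exI[of _ t] conjI refl)
          with ut(2) disj show False by (meson disjoint_iff)
        qed
        then show "x \<in> h" by (simp add: h lower_halfspace_def)
      qed
    qed
  qed
  ultimately show ?thesis by simp
qed

lemma convex_process_cell: "convex (process_cell K \<xi> n \<omega>)"
  unfolding process_cell_def K_cell_def lower_halfspace_def
  by (rule convex_Inter) (auto simp: convex_halfspace_le inner_commute)

lemma subset_process_cell: "K \<subseteq> process_cell K \<xi> n \<omega>"
  unfolding process_cell_def K_cell_def by blast

section \<open>Spherical caps\<close>

lemma cap_measurable: "sphere 0 1 \<inter> cball v \<rho> \<in> sets (sphere_borel :: 'a::euclidean_space measure)"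
  by (simp add: sets_restrict_space_iff)

text \<open>The cone over a cap of radius \<open>\<rho>\<close> is comparable to about \<open>1 / \<rho>\<close> balls of radius of order \<open>\<rho>\<close>
  strung along its axis; this bounds its volume on both sides.\<close>

lemma sphere_lebesgue_cap_ge:
  fixes v :: "'a::euclidean_space"
  assumes v: "norm v = 1" and \<rho>: "0 < \<rho>" "\<rho> \<le> 1"
  shows "emeasure sphere_lebesgue (sphere 0 1 \<inter> cball v \<rho>) \<ge>
    ennreal (unit_ball_vol (real DIM('a)) / 8 ^ DIM('a) * \<rho> ^ (DIM('a) - 1))"
proof -
  \<comment> \<open>The centres lie at heights between 1/2 and 3/4, so points of the balls have norm
    at least 1/4 and directions within \<open>2 * \<delta> / (1 / 4) = \<rho>\<close> of
    \<open>v\<close>. The spacing \<open>2 * \<delta>\<close> makes the open balls disjoint, and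
    there are at least \<open>1 / \<rho>\<close> of them.\<close>
  define \<delta> where "\<delta> = \<rho> / 8"
  define N where "N = nat \<lfloor>1 / \<rho>\<rfloor>"
  define s where "s j = 1 / 2 + 2 * \<delta> * real j" for j :: nat
  let ?C = "{r *\<^sub>R u |r u. 0 < r \<and> r \<le> 1 \<and> u \<in> sphere 0 1 \<inter> cball v \<rho>}"
  have \<delta>: "0 < \<delta>" "\<delta> \<le> 1 / 8" using \<rho> by (auto simp: \<delta>_def)
  have s: "1 / 2 \<le> s j" "s j \<le> 3 / 4" if "j \<in> {..N}" for j
  proof -
    have "real N = of_int \<lfloor>1 / \<rho>\<rfloor>" using \<rho> by (simp add: N_def)
    then have "real N \<le> 1 / \<rho>" by linarith
    moreover have "real j \<le> real N" using that by simp
    ultimately have "real j \<le> 1 / \<rho>" by linarith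
    then have "\<rho> * real j \<le> 1" using \<rho> by (simp add: field_simps)
    then show "s j \<le> 3 / 4" by (simp add: s_def \<delta>_def)
    show "1 / 2 \<le> s j" using \<delta> by (simp add: s_def)
  qed
  have sub: "(\<Union>j\<in>{..N}. ball (s j *\<^sub>R v) \<delta>) \<subseteq> ?C"
  proof
    fix w assume "w \<in> (\<Union>j\<in>{..N}. ball (s j *\<^sub>R v) \<delta>)"
    then obtain j where j: "j \<in> {..N}" and w: "norm (w - s j *\<^sub>R v) < \<delta>"
      by (auto simp: dist_norm norm_minus_commute)
    have nsv: "norm (s j *\<^sub>R v) = s j" using v s[OF j] by simp
    have "\<bar>norm w - s j\<bar> < \<delta>"
      using norm_triangle_ineq3[of w "s j *\<^sub>R v"] w nsv by simp
    with s[OF j] \<delta> have nw: "1 / 4 \<le> norm w" "norm w \<le> 1" "\<bar>s j - norm w\<bar> < \<delta>" by auto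
    then have w0: "w \<noteq> 0" by auto
    have "norm w * norm (sgn w - v) = norm (norm w *\<^sub>R (sgn w - v))" by simp
    also have "norm w *\<^sub>R (sgn w - v) = w - norm w *\<^sub>R v"
      using w0 by (simp add: scaleR_diff_right sgn_div_norm)
    also have "norm (w - norm w *\<^sub>R v) = norm ((w - s j *\<^sub>R v) + (s j - norm w) *\<^sub>R v)"
      by (simp add: algebra_simps)
    also have "\<dots> \<le> norm (w - s j *\<^sub>R v) + norm ((s j - norm w) *\<^sub>R v)"
      by (rule norm_triangle_ineq)
    also have "\<dots> \<le> 2 * \<delta>" using w nw v by simp
    also have "\<dots> \<le> norm w * \<rho>"
      using mult_right_mono[OF nw(1), of \<rho>] \<rho> by (simp add: \<delta>_def)
    finally have "norm (sgn w - v) \<le> \<rho>"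
      using w0 by simp
    then have "sgn w \<in> sphere 0 1 \<inter> cball v \<rho>"
      using w0 by (simp add: norm_sgn dist_norm norm_minus_commute)
    moreover have "w = norm w *\<^sub>R sgn w" using w0 by (simp add: sgn_div_norm)
    ultimately show "w \<in> ?C" using nw by fastforce
  qed
  have disj: "disjoint_family_on (\<lambda>j. ball (s j *\<^sub>R v) \<delta>) {..N}"
    unfolding disjoint_family_on_def
  proof (intro ballI impI)
    fix i j :: nat assume "i \<noteq> j"
    then have "1 \<le> \<bar>real i - real j\<bar>" by linarith
    then have "2 * \<delta> \<le> 2 * \<delta> * \<bar>real i - real j\<bar>"
      using \<delta> by simp
    also have "\<dots> = \<bar>2 * \<delta> * (real i - real j)\<bar>"
      using \<delta> by (simp add: abs_mult)
    also have "\<dots> = dist (s i *\<^sub>R v) (s j *\<^sub>R v)"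
      using v by (simp add: dist_norm s_def algebra_simps flip: scaleR_diff_left)
    finally show "ball (s i *\<^sub>R v) \<delta> \<inter> ball (s j *\<^sub>R v) \<delta> = {}"
      by (intro disjoint_ballI) simp
  qed
  have "1 / \<rho> \<le> real (Suc N)"
    using \<rho> unfolding N_def by linarith
  then have "unit_ball_vol (real DIM('a)) * \<delta> ^ DIM('a) * (1 / \<rho>) \<le>
      unit_ball_vol (real DIM('a)) * \<delta> ^ DIM('a) * real (Suc N)"
    using \<delta> by (intro mult_left_mono mult_nonneg_nonneg) (auto intro: less_imp_le)
  also have "unit_ball_vol (real DIM('a)) * \<delta> ^ DIM('a) * (1 / \<rho>) =
      unit_ball_vol (real DIM('a)) / 8 ^ DIM('a) * \<rho> ^ (DIM('a) - 1)"
    using \<rho> power_eq_if[of \<rho> "DIM('a)"] by (simp add: \<delta>_def power_divide)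
  finally have le: "unit_ball_vol (real DIM('a)) / 8 ^ DIM('a) * \<rho> ^ (DIM('a) - 1) \<le>
      real (Suc N) * (unit_ball_vol (real DIM('a)) * \<delta> ^ DIM('a))" by (simp add: mult_ac)
  have "ennreal (real (Suc N) * (unit_ball_vol (real DIM('a)) * \<delta> ^ DIM('a))) =
      (\<Sum>j\<in>{..N}. emeasure lborel (ball (s j *\<^sub>R v) \<delta>))"
    using \<delta> by (simp add: emeasure_ball ennreal_mult ennreal_of_nat_eq_real_of_nat)
  also have "\<dots> = emeasure lborel (\<Union>j\<in>{..N}. ball (s j *\<^sub>R v) \<delta>)"
    by (rule sum_emeasure[OF _ disj]) auto
  also have "\<dots> \<le> emeasure lborel ?C"
  proof (rule emeasure_mono[OF sub])
    have "?C = {x. 0 < norm x \<and> norm x \<le> 1 \<and> sgn x \<in> sphere 0 1 \<inter> cball v \<rho>}"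
      by (rule sphere_cone_eq) simp
    also have "\<dots> = {x. 0 < norm x \<and> norm x \<le> 1} \<inter> (sgn -` (sphere 0 1 \<inter> cball v \<rho>) \<inter> space borel)"
      by auto
    finally have C: "?C = \<dots>" .
    have "(sgn :: 'a \<Rightarrow> 'a) \<in> borel_measurable borel"
      unfolding sgn_div_norm[abs_def] by measurable
    moreover have "sphere 0 1 \<inter> cball v \<rho> \<in> sets borel" by simp
    ultimately have "sgn -` (sphere 0 1 \<inter> cball v \<rho>) \<inter> space borel \<in> sets borel"
      by (rule measurable_sets)
    moreover have "{x::'a. 0 < norm x \<and> norm x \<le> 1} \<in> sets borel" by measurable
    ultimately show "?C \<in> sets lborel" unfolding C by simp
  qed
  also have "\<dots> \<le> of_nat DIM('a) * emeasure lborel ?C"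
    using mult_right_mono[of "1 :: ennreal" "of_nat DIM('a)" "emeasure lborel ?C"]
      of_nat_mono[of 1 "DIM('a)", where 'a=ennreal] DIM_positive[where 'a='a]
    by (simp add: Suc_le_eq)
  also have "\<dots> = emeasure sphere_lebesgue (sphere 0 1 \<inter> cball v \<rho>)"
    by (rule emeasure_sphere_lebesgue[symmetric, OF cap_measurable])
  finally show ?thesis
    using le by (meson ennreal_leI order_trans)
qed

lemma sphere_lebesgue_cap_le:
  fixes v :: "'a::euclidean_space"
  assumes v: "norm v = 1" and \<rho>: "0 < \<rho>" "\<rho> \<le> 1"
  shows "emeasure sphere_lebesgue (sphere 0 1 \<inter> cball v \<rho>) \<le>
    ennreal (real DIM('a) * unit_ball_vol (real DIM('a)) * 2 ^ (DIM('a) + 1) * \<rho> ^ (DIM('a) - 1))"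
proof -
  define N where "N = nat \<lfloor>1 / \<rho>\<rfloor>"
  define s where "s j = real j * \<rho>" for j :: nat
  let ?C = "{r *\<^sub>R u |r u. 0 < r \<and> r \<le> 1 \<and> u \<in> sphere 0 1 \<inter> cball v \<rho>}"
  \<comment> \<open>One \<open>\<rho>\<close> of the radius pays for replacing \<open>u\<close> by
    \<open>v\<close> (as \<open>r \<le> 1\<close>), the other for rounding \<open>r\<close> down to
    a multiple of \<open>\<rho>\<close>.\<close>
  have sub: "?C \<subseteq> (\<Union>j\<in>{..N}. cball (s j *\<^sub>R v) (2 * \<rho>))"
  proof
    fix w assume "w \<in> ?C"
    then obtain r u where w: "w = r *\<^sub>R u" and r: "0 < r" "r \<le> 1" and u: "norm u = 1" "norm (u - v) \<le> \<rho>"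
      by (auto simp: dist_norm norm_minus_commute)
    define j where "j = nat \<lfloor>r / \<rho>\<rfloor>"
    have rj: "real j = of_int \<lfloor>r / \<rho>\<rfloor>" using r \<rho> by (simp add: j_def)
    then have "real j \<le> r / \<rho>" "r / \<rho> \<le> real j + 1" by linarith+
    then have "\<bar>r - s j\<bar> \<le> \<rho>"
      using \<rho> by (simp add: s_def field_simps)
    have "j \<le> N"
      unfolding j_def N_def using r \<rho> by (intro nat_mono floor_mono divide_right_mono) auto
    have "norm (w - s j *\<^sub>R v) = norm (r *\<^sub>R (u - v) + (r - s j) *\<^sub>R v)"
      unfolding w by (simp add: algebra_simps)
    also have "\<dots> \<le> norm (r *\<^sub>R (u - v)) + norm ((r - s j) *\<^sub>R v)"
      by (rule norm_triangle_ineq)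
    also have "\<dots> \<le> 1 * \<rho> + \<rho>"
    proof (rule add_mono)
      show "norm (r *\<^sub>R (u - v)) \<le> 1 * \<rho>"
        using mult_mono[OF r(2) u(2)] r by simp
      show "norm ((r - s j) *\<^sub>R v) \<le> \<rho>"
        using v \<open>\<bar>r - s j\<bar> \<le> \<rho>\<close> by simp
    qed
    finally show "w \<in> (\<Union>j\<in>{..N}. cball (s j *\<^sub>R v) (2 * \<rho>))"
      using \<open>j \<le> N\<close> by (auto simp: dist_norm norm_minus_commute)
  qed
  have "real N = of_int \<lfloor>1 / \<rho>\<rfloor>" using \<rho> by (simp add: N_def)
  then have "real N \<le> 1 / \<rho>" by linarith
  moreover have "1 \<le> 1 / \<rho>" using \<rho> by simp
  ultimately have N: "real (Suc N) \<le> 2 / \<rho>" by simp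
  have "emeasure lborel ?C \<le> emeasure lborel (\<Union>j\<in>{..N}. cball (s j *\<^sub>R v) (2 * \<rho>))"
    by (rule emeasure_mono[OF sub]) auto
  also have "\<dots> \<le> (\<Sum>j\<in>{..N}. emeasure lborel (cball (s j *\<^sub>R v) (2 * \<rho>)))"
    by (rule emeasure_subadditive_finite) auto
  also have "\<dots> = ennreal (real (Suc N) * (unit_ball_vol (real DIM('a)) * (2 * \<rho>) ^ DIM('a)))"
    using \<rho> by (simp add: emeasure_cball ennreal_mult ennreal_of_nat_eq_real_of_nat)
  also have "\<dots> \<le> ennreal (2 / \<rho> * (unit_ball_vol (real DIM('a)) * (2 * \<rho>) ^ DIM('a)))"
    using N \<rho> by (intro ennreal_leI mult_right_mono mult_nonneg_nonneg) (auto intro: less_imp_le)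
  also have "2 / \<rho> * (unit_ball_vol (real DIM('a)) * (2 * \<rho>) ^ DIM('a)) =
      unit_ball_vol (real DIM('a)) * 2 ^ (DIM('a) + 1) * \<rho> ^ (DIM('a) - 1)"
    using \<rho> power_eq_if[of \<rho> "DIM('a)"] by (simp add: power_mult_distrib)
  finally have "of_nat DIM('a) * emeasure lborel ?C \<le> of_nat DIM('a) *
      ennreal (unit_ball_vol (real DIM('a)) * 2 ^ (DIM('a) + 1) * \<rho> ^ (DIM('a) - 1))"
    by (rule mult_left_mono) simp
  also have "\<dots> = ennreal (real DIM('a) * unit_ball_vol (real DIM('a)) * 2 ^ (DIM('a) + 1) * \<rho> ^ (DIM('a) - 1))"
    using \<rho> by (simp add: ennreal_mult ennreal_of_nat_eq_real_of_nat mult.assoc flip: ennreal_mult)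
  finally show ?thesis
    by (simp only: emeasure_sphere_lebesgue[OF cap_measurable])
qed

section \<open>Geometry of separating hyperplanes\<close>

text \<open>Some translate of the ball inside \<open>K\<close> contains \<open>p\<close>. Its top
  point in direction \<open>v\<close> is not higher than \<open>p\<close>, while \<open>p\<close> is
  within \<open>r\<close> of its centre; the equality case of Cauchy--Schwarz forces the centre to
  be \<open>p - r *\<^sub>R v\<close>.\<close>

lemma slides_freely_cball_support_point:
  fixes K :: "'a::euclidean_space set"
  assumes sl: "slides_freely_inside (cball x r) K" and r: "0 < r"
    and p: "p \<in> K" and v: "norm v = 1" and sup: "\<And>k. k \<in> K \<Longrightarrow> k \<bullet> v \<le> p \<bullet> v"
  shows "cball (p - r *\<^sub>R v) r \<subseteq> K"
proof -
  obtain t where t: "(+) t ` cball x r \<subseteq> K" "p \<in> (+) t ` cball x r"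
    using sl p unfolding slides_freely_inside_def by blast
  have im: "(+) t ` cball x r = cball (t + x) r" by (subst image_add_cball) (simp add: add.commute)
  let ?c = "t + x"
  have "?c + r *\<^sub>R v \<in> cball ?c r" using v r by (simp add: dist_norm)
  then have "(?c + r *\<^sub>R v) \<bullet> v \<le> p \<bullet> v" using t(1) sup unfolding im by blast
  moreover have vv: "v \<bullet> v = 1" using v by (simp add: dot_square_norm)
  ultimately have ge: "r \<le> (p - ?c) \<bullet> v" by (simp add: inner_simps)
  have n: "norm (p - ?c) \<le> r" using t(2) unfolding im by (simp add: dist_norm norm_minus_commute)
  then have "(p - ?c) \<bullet> (p - ?c) \<le> r\<^sup>2" by (metis dot_square_norm norm_ge_zero power_mono)
  then have "(p - ?c - r *\<^sub>R v) \<bullet> (p - ?c - r *\<^sub>R v) \<le> 2 * r\<^sup>2 - 2 * r * ((p - ?c) \<bullet> v)"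
    using vv by (simp add: inner_simps inner_commute power2_eq_square algebra_simps)
  also have "\<dots> \<le> 0"
    using mult_left_mono[OF ge, of r] r by (simp add: power2_eq_square)
  finally have "p - ?c - r *\<^sub>R v = 0" by (metis inner_gt_zero_iff not_le)
  then have "p - r *\<^sub>R v = ?c" by (simp add: algebra_simps)
  then show ?thesis using t(1) unfolding im by simp
qed

text \<open>Dual to the previous argument: some translate of \<open>K\<close> inside the ball
  reaches the ball's top point in direction \<open>v\<close>. The translated \<open>p\<close> is at
  least as high and still in the ball, so it is that top point, which fixes the position of the ball
  relative to \<open>K\<close>.\<close>

lemma slides_freely_inside_cball_support_point:
  fixes K :: "'a::euclidean_space set"
  assumes sl: "slides_freely_inside K (cball x R)" and R: "0 < R"
    and p: "p \<in> K" and v: "norm v = 1" and sup: "\<And>k. k \<in> K \<Longrightarrow> k \<bullet> v \<le> p \<bullet> v"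
  shows "K \<subseteq> cball (p - R *\<^sub>R v) R"
proof -
  have vv: "v \<bullet> v = 1" using v by (simp add: dot_square_norm)
  have "x + R *\<^sub>R v \<in> cball x R" using v R by (simp add: dist_norm)
  moreover have "cball x R = \<Union>{(+) t ` K |t. (+) t ` K \<subseteq> cball x R}"
    using sl unfolding slides_freely_inside_def .
  ultimately have "x + R *\<^sub>R v \<in> \<Union>{(+) t ` K |t. (+) t ` K \<subseteq> cball x R}"
    by (rule subst[rotated])
  then obtain t where t: "(+) t ` K \<subseteq> cball x R" and "x + R *\<^sub>R v \<in> (+) t ` K"
    by blast
  then obtain k where k: "k \<in> K" "t + k = x + R *\<^sub>R v"
    by force
  have "k \<bullet> v \<le> p \<bullet> v" using sup k by blast
  then have "(x + R *\<^sub>R v - t) \<bullet> v \<le> p \<bullet> v" using k(2) by (metis add_diff_cancel_left')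
  then have ge: "R \<le> (t + p - x) \<bullet> v" using vv by (simp add: inner_simps)
  have "t + p \<in> cball x R" using t p by blast
  then have "norm (t + p - x) \<le> R" by (simp add: dist_norm norm_minus_commute)
  then have "(t + p - x) \<bullet> (t + p - x) \<le> R\<^sup>2" by (metis dot_square_norm norm_ge_zero power_mono)
  then have "(t + p - x - R *\<^sub>R v) \<bullet> (t + p - x - R *\<^sub>R v) \<le> 2 * R\<^sup>2 - 2 * R * ((t + p - x) \<bullet> v)"
    using vv by (simp add: inner_simps inner_commute power2_eq_square algebra_simps)
  also have "\<dots> \<le> 0"
    using mult_left_mono[OF ge, of R] R by (simp add: power2_eq_square)
  finally have "t + p - x - R *\<^sub>R v = 0" by (metis inner_gt_zero_iff not_le)
  then have eq: "p - R *\<^sub>R v = x - t" by (simp add: algebra_simps)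
  show ?thesis
  proof
    fix k assume "k \<in> K"
    then have "t + k \<in> cball x R" using t by blast
    then show "k \<in> cball (p - R *\<^sub>R v) R"
      unfolding eq by (simp add: dist_norm algebra_simps)
  qed
qed

lemma norm_diff_unit_vectors:
  fixes u v :: "'a::real_inner"
  assumes "norm u = 1" "norm v = 1"
  shows "(norm (u - v))\<^sup>2 = 2 * (1 - v \<bullet> u)"
proof -
  have "u \<bullet> u = 1" "v \<bullet> v = 1"
    using assms by (simp_all add: dot_square_norm)
  then show ?thesis
    unfolding power2_norm_eq_inner by (simp add: inner_simps inner_commute)
qed

text \<open>The hyperplane has to clear the inner ball touching at \<open>p\<close>, so
  \<open>t > p \<bullet> u + r * (1 - v \<bullet> u)\<close>, and it has to stay below
  \<open>p + e *\<^sub>R v\<close>, so \<open>t < p \<bullet> u + e * (v \<bullet> u)\<close>.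
  Together these give \<open>r * (1 - v \<bullet> u) \<le> e\<close>.\<close>

lemma separating_layer_outer:
  fixes K :: "'a::euclidean_space set"
  assumes r: "0 < r" and p: "p \<in> K" and v: "norm v = 1" and ball: "cball (p - r *\<^sub>R v) r \<subseteq> K"
    and e: "0 < e" and u: "norm u = 1" and ut: "(u, t) \<in> separating K (p + e *\<^sub>R v) 0"
  shows "norm (u - v) \<le> sqrt (2 * e / r)" and "p \<bullet> u < t" and "t < p \<bullet> u + e"
proof -
  have sep: "k \<bullet> u < t" if "k \<in> K" for k using ut that by (simp add: separating_def)
  have t: "t < p \<bullet> u + e * (v \<bullet> u)" using ut by (simp add: separating_def inner_simps)
  show "p \<bullet> u < t" using sep p by blast
  have vu: "v \<bullet> u \<le> 1" using norm_cauchy_schwarz[of v u] u v by simp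
  then have "e * (v \<bullet> u) \<le> e" using e by (simp add: mult_left_le)
  with t show "t < p \<bullet> u + e" by linarith
  have "p - r *\<^sub>R v + r *\<^sub>R u \<in> cball (p - r *\<^sub>R v) r" using r u by (simp add: dist_norm)
  then have "(p - r *\<^sub>R v + r *\<^sub>R u) \<bullet> u < t" using ball sep by blast
  moreover have "u \<bullet> u = 1" using u by (simp add: dot_square_norm)
  ultimately have "p \<bullet> u - r * (v \<bullet> u) + r < t" by (simp add: inner_simps)
  with t \<open>e * (v \<bullet> u) \<le> e\<close> have "r * (1 - v \<bullet> u) \<le> e" by (simp add: algebra_simps)
  then have "1 - v \<bullet> u \<le> e / r" using r by (simp add: field_simps)
  then have "(norm (u - v))\<^sup>2 \<le> 2 * e / r" by (simp add: norm_diff_unit_vectors[OF u v])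
  then show "norm (u - v) \<le> sqrt (2 * e / r)" by (rule real_le_rsqrt)
qed

text \<open>The direction \<open>v\<close> from the nearest point \<open>p\<close> to
  \<open>y\<close> is an outer normal, so \<open>K\<close> lies in the touching ball with centre
  \<open>z = p - R *\<^sub>R v\<close>. The layer starts at the support function
  \<open>z \<bullet> u + R\<close> of that ball instead of that of \<open>K\<close>, which makes its
  lower end affine in \<open>u\<close>. On the cap, \<open>y \<bullet> u\<close> exceeds this value
  by at least \<open>e / 2\<close>: one \<open>e / 4\<close> is the height of the layer, the other
  the slack.\<close>

lemma separating_layer_inner:
  fixes K :: "'a::euclidean_space set"
  assumes K: "convex K" "compact K" "K \<noteq> {}"
    and sl: "slides_freely_inside K (cball x R)" and R: "0 < R"
    and e: "0 < e" "e \<le> R" "e \<le> infdist y K"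
  obtains v z s where "norm v = 1"
    "\<And>u t. u \<in> sphere 0 1 \<inter> cball v (sqrt (e / (2 * R))) \<Longrightarrow> z \<bullet> u + s < t \<Longrightarrow>
       t < z \<bullet> u + s + e / 4 \<Longrightarrow> (u, t) \<in> separating K y (e / 4)"
proof -
  obtain p where p: "p \<in> K" "infdist y K = dist y p"
    using infdist_attains_inf[OF compact_imp_closed[OF K(2)] K(3)] by blast
  define \<epsilon> where "\<epsilon> = norm (y - p)"
  define v where "v = (1 / \<epsilon>) *\<^sub>R (y - p)"
  have \<epsilon>: "e \<le> \<epsilon>" using e(3) p(2) by (simp add: \<epsilon>_def dist_norm)
  with e have \<epsilon>0: "0 < \<epsilon>" by linarith
  have v: "norm v = 1" using \<epsilon>0 by (simp add: v_def \<epsilon>_def)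
  have y: "y = p + \<epsilon> *\<^sub>R v" using \<epsilon>0 by (simp add: v_def)
  have "k \<bullet> v \<le> p \<bullet> v" if "k \<in> K" for k
  proof -
    have "(y - p) \<bullet> (k - p) \<le> 0"
      by (rule any_closest_point_dot[OF K(1) compact_imp_closed[OF K(2)] p(1) that])
         (simp add: p(2)[symmetric] infdist_le)
    then have "\<epsilon> * (v \<bullet> (k - p)) \<le> 0" using y by simp
    then have "v \<bullet> (k - p) \<le> 0" using \<epsilon>0 by (simp add: mult_le_0_iff)
    then show ?thesis by (simp add: inner_simps inner_commute)
  qed
  then have sub: "K \<subseteq> cball (p - R *\<^sub>R v) R"
    by (rule slides_freely_inside_cball_support_point[OF sl R p(1) v])
  show ?thesis
  proof (rule that[OF v])
    fix u t assume u: "u \<in> sphere 0 1 \<inter> cball v (sqrt (e / (2 * R)))"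
      and t: "(p - R *\<^sub>R v) \<bullet> u + R < t" "t < (p - R *\<^sub>R v) \<bullet> u + R + e / 4"
    have nu: "norm u = 1" and uv: "norm (u - v) \<le> sqrt (e / (2 * R))"
      using u by (simp_all add: dist_norm norm_minus_commute)
    have "k \<bullet> u < t" if k: "k \<in> K" for k
    proof -
      have "(k - (p - R *\<^sub>R v)) \<bullet> u \<le> norm (k - (p - R *\<^sub>R v)) * norm u"
        by (rule norm_cauchy_schwarz)
      also have "\<dots> \<le> R" using k sub nu by (auto simp: dist_norm norm_minus_commute)
      finally show ?thesis using t(1) by (simp add: inner_simps)
    qed
    moreover have "t < y \<bullet> u - e / 4"
    proof -
      have "(norm (u - v))\<^sup>2 \<le> e / (2 * R)"
        using power_mono[OF uv norm_ge_zero, of 2] e R by simp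
      then have w: "1 - v \<bullet> u \<le> e / (4 * R)"
        unfolding norm_diff_unit_vectors[OF nu v] by simp
      \<comment> \<open>The tilt of \<open>u\<close> against \<open>v\<close> costs at most
        \<open>\<epsilon> / 4 + e / 4\<close> out of the available \<open>\<epsilon>\<close>, where
        \<open>e \<le> \<epsilon>\<close>.\<close>
      have "(\<epsilon> + R) * (1 - v \<bullet> u) \<le> (\<epsilon> + R) * (e / (4 * R))"
        using w \<epsilon>0 R by (intro mult_left_mono) auto
      also have "\<dots> = \<epsilon> * (e / R) / 4 + e / 4" using R by (simp add: field_simps)
      also have "\<epsilon> * (e / R) \<le> \<epsilon> * 1"
        using e R \<epsilon>0 by (intro mult_left_mono) auto
      finally have "(\<epsilon> + R) * (1 - v \<bullet> u) \<le> \<epsilon> / 4 + e / 4" by simp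
      moreover have "y \<bullet> u = (p - R *\<^sub>R v) \<bullet> u + R + \<epsilon> - (\<epsilon> + R) * (1 - v \<bullet> u)"
        unfolding y by (simp add: inner_simps algebra_simps)
      ultimately show ?thesis using t(2) \<epsilon> by linarith
    qed
    ultimately show "(u, t) \<in> separating K y (e / 4)" by (simp add: separating_def)
  qed
qed

lemma infdist_add_normal:
  fixes K :: "'a::euclidean_space set"
  assumes p: "p \<in> K" and v: "norm v = 1" and sup: "\<And>k. k \<in> K \<Longrightarrow> k \<bullet> v \<le> p \<bullet> v"
  shows "e \<le> infdist (p + e *\<^sub>R v) K"
proof -
  have "e \<le> dist (p + e *\<^sub>R v) k" if "k \<in> K" for k
  proof -
    have "e \<le> (p + e *\<^sub>R v - k) \<bullet> v"
      using sup[OF that] v by (simp add: inner_simps dot_square_norm)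
    also have "\<dots> \<le> norm (p + e *\<^sub>R v - k) * norm v" by (rule norm_cauchy_schwarz)
    finally show ?thesis using v by (simp add: dist_norm)
  qed
  then show ?thesis using p by (auto simp: infdist_def intro: cINF_greatest)
qed

text \<open>Source of the exponent: layer length \<open>x\<close> times the measure factor of a cap
  of radius of order \<open>sqrt x\<close>.\<close>

lemma mult_sqrt_power_eq_powr:
  assumes "0 < x" "1 \<le> d"
  shows "x * sqrt x ^ (d - 1) = x powr ((real d + 1) / 2)"
proof -
  have "sqrt x ^ (d - 1) = x powr ((real d - 1) / 2)"
    using assms by (simp add: powr_half_sqrt[symmetric] powr_power of_nat_diff)
  then have "x * sqrt x ^ (d - 1) = x powr 1 * x powr ((real d - 1) / 2)"
    using assms by simp
  also have "\<dots> = x powr (1 + (real d - 1) / 2)" by (rule powr_add[symmetric])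
  also have "1 + (real d - 1) / 2 = (real d + 1) / 2" by (simp add: field_simps)
  finally show ?thesis .
qed

text \<open>The arc is parametrised by its coordinate along \<open>b2\<close>, so distances on it
  are bounded below by differences of parameters. This supplies many well separated unit normals
  explicitly.\<close>

lemma unit_arc:
  fixes b1 b2 :: "'a::euclidean_space" and s s' :: real
  assumes b: "b1 \<in> Basis" "b2 \<in> Basis" "b1 \<noteq> b2" and s: "\<bar>s\<bar> \<le> 1"
  shows "norm (sqrt (1 - s\<^sup>2) *\<^sub>R b1 + s *\<^sub>R b2) = 1"
    and "\<bar>s - s'\<bar> \<le> norm ((sqrt (1 - s\<^sup>2) *\<^sub>R b1 + s *\<^sub>R b2) - (sqrt (1 - s'\<^sup>2) *\<^sub>R b1 + s' *\<^sub>R b2))"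
proof -
  have i: "b1 \<bullet> b1 = 1" "b2 \<bullet> b2 = 1" "b1 \<bullet> b2 = 0" "b2 \<bullet> b1 = 0"
    using b by (simp_all add: inner_Basis)
  have "s\<^sup>2 \<le> 1" using s by (simp add: abs_square_le_1)
  then have "(norm (sqrt (1 - s\<^sup>2) *\<^sub>R b1 + s *\<^sub>R b2))\<^sup>2 = 1"
    unfolding power2_norm_eq_inner by (simp add: inner_simps i) (simp add: power2_eq_square flip: mult.assoc)
  then show "norm (sqrt (1 - s\<^sup>2) *\<^sub>R b1 + s *\<^sub>R b2) = 1"
    using power2_eq_iff_nonneg[OF norm_ge_zero zero_le_one] by (metis one_power2)
  have "s - s' = ((sqrt (1 - s\<^sup>2) *\<^sub>R b1 + s *\<^sub>R b2) - (sqrt (1 - s'\<^sup>2) *\<^sub>R b1 + s' *\<^sub>R b2)) \<bullet> b2"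
    by (simp add: inner_simps i)
  then show "\<bar>s - s'\<bar> \<le> norm ((sqrt (1 - s\<^sup>2) *\<^sub>R b1 + s *\<^sub>R b2) - (sqrt (1 - s'\<^sup>2) *\<^sub>R b1 + s' *\<^sub>R b2))"
    by (simp only: Basis_le_norm[OF b(2)])
qed

section \<open>Intensity and void probabilities\<close>

text \<open>The intensity uses only parameters with \<open>t \<ge> 0\<close>, while \<open>W\<close>
  may contain either parameter of a hyperplane; hence the disjunction.\<close>

lemma emeasure_intensity_hyperplanes_of:
  fixes \<phi> :: "'a::euclidean_space measure"
  assumes \<phi>: "sets \<phi> = sets sphere_borel" and W: "open W"
  shows "emeasure (hyperplane_intensity \<phi> 1) (hyperplanes_of W) =
    2 * (\<integral>\<^sup>+u. emeasure lborel ({0..} \<inter> {t. (u, t) \<in> W \<or> (- u, - t) \<in> W}) \<partial>\<phi>)"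
proof -
  have "(\<integral>\<^sup>+t\<in>{0..}. indicator (hyperplanes_of W) (hyperplane u t) \<partial>lborel) =
      emeasure lborel ({0..} \<inter> {t. (u, t) \<in> W \<or> (- u, - t) \<in> W})" if "u \<in> space \<phi>" for u
  proof -
    have u: "u \<in> sphere 0 1"
      using that sets_eq_imp_space_eq[OF \<phi>] by (simp add: space_restrict_space)
    have "open ((\<lambda>t. (u, t)) -` W)" "open ((\<lambda>t. (- u, - t)) -` W)"
      by (intro open_vimage W continuous_intros)+
    then have m: "{t. (u, t) \<in> W \<or> (- u, - t) \<in> W} \<in> sets lborel"
      by (simp add: Collect_disj_eq vimage_def)
    have "(\<integral>\<^sup>+t\<in>{0..}. indicator (hyperplanes_of W) (hyperplane u t) \<partial>lborel) =
        (\<integral>\<^sup>+t. indicator ({0..} \<inter> {t. (u, t) \<in> W \<or> (- u, - t) \<in> W}) t \<partial>lborel)"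
      by (intro nn_integral_cong)
         (auto simp: indicator_def hyperplane_mem_hyperplanes_of[OF u])
    also have "\<dots> = emeasure lborel ({0..} \<inter> {t. (u, t) \<in> W \<or> (- u, - t) \<in> W})"
      using m by (intro nn_integral_indicator) auto
    finally show ?thesis .
  qed
  then show ?thesis
    unfolding emeasure_hyperplane_intensity[OF \<phi> sets_hyperplanes_of[OF W]]
    by (simp cong: nn_integral_cong)
qed

text \<open>These are the hyperplanes at distance less than \<open>B\<close> from the origin. They
  exhaust the space, which yields sigma-finiteness, and they majorize the separating sets.\<close>

lemma intensity_strip_le:
  fixes \<phi> :: "'a::euclidean_space measure"
  assumes \<phi>: "sets \<phi> = sets sphere_borel" "prob_space \<phi>" and B: "0 \<le> B"
  shows "emeasure (hyperplane_intensity \<phi> 1) (hyperplanes_of (UNIV \<times> {- B<..<B})) \<le> ennreal (2 * B)"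
proof -
  interpret prob_space \<phi> by fact
  have op: "open ((UNIV :: 'a set) \<times> {- B<..<B})" by (intro open_Times) auto
  have "emeasure lborel ({0..} \<inter> {t. (u, t) \<in> UNIV \<times> {- B<..<B} \<or> (- u, - t) \<in> UNIV \<times> {- B<..<B}}) \<le> ennreal B"
    for u :: 'a
  proof -
    have "emeasure lborel ({0..} \<inter> {t. (u, t) \<in> UNIV \<times> {- B<..<B} \<or> (- u, - t) \<in> UNIV \<times> {- B<..<B}})
        \<le> emeasure lborel {0..B}"
      by (rule emeasure_mono) auto
    then show ?thesis using B by simp
  qed
  then have "(\<integral>\<^sup>+u. emeasure lborel ({0..} \<inter> {t. (u, t) \<in> UNIV \<times> {- B<..<B} \<or> (- u, - t) \<in> UNIV \<times> {- B<..<B}}) \<partial>\<phi>)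
      \<le> (\<integral>\<^sup>+u. ennreal B \<partial>\<phi>)"
    by (rule nn_integral_mono)
  also have "\<dots> = ennreal B" by (simp add: emeasure_space_1)
  finally have "2 * (\<integral>\<^sup>+u. emeasure lborel ({0..} \<inter> {t. (u, t) \<in> UNIV \<times> {- B<..<B} \<or> (- u, - t) \<in> UNIV \<times> {- B<..<B}}) \<partial>\<phi>)
      \<le> 2 * ennreal B" by (rule mult_left_mono) simp
  also have "2 * ennreal B = ennreal (2 * B)" using B by (simp add: ennreal_mult)
  finally show ?thesis unfolding emeasure_intensity_hyperplanes_of[OF \<phi>(1) op] .
qed

lemma sigma_finite_intensity:
  fixes \<phi> :: "'a::euclidean_space measure"
  assumes \<phi>: "sets \<phi> = sets sphere_borel" "prob_space \<phi>"
  shows "sigma_finite_measure (hyperplane_intensity \<phi> 1)"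
proof
  have sp: "space (hyperplane_intensity \<phi> 1) = (hyperplanes :: 'a set set)"
    using sets_eq_imp_space_eq[OF sets_hyperplane_intensity] space_hyperplane_borel by blast
  have op: "open ((UNIV :: 'a set) \<times> {- B<..<B})" for B :: real by (intro open_Times) auto
  let ?\<A> = "range (\<lambda>B::nat. hyperplanes_of (UNIV \<times> {- real B<..<real B}) :: 'a set set)"
  show "\<exists>A::'a set set set. countable A \<and> A \<subseteq> sets (hyperplane_intensity \<phi> 1) \<and>
      \<Union>A = space (hyperplane_intensity \<phi> 1) \<and> (\<forall>a\<in>A. emeasure (hyperplane_intensity \<phi> 1) a \<noteq> \<infinity>)"
  proof (intro exI[of _ ?\<A>] conjI)
    show "?\<A> \<subseteq> sets (hyperplane_intensity \<phi> 1)"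
      using sets_hyperplanes_of[OF op] by (auto simp: sets_hyperplane_intensity)
    show "\<Union>?\<A> = space (hyperplane_intensity \<phi> 1)"
    proof (intro equalityI subsetI)
      fix H assume "H \<in> \<Union>?\<A>"
      then show "H \<in> space (hyperplane_intensity \<phi> 1)"
        unfolding sp hyperplanes_def hyperplanes_of_def by blast
    next
      fix H assume "H \<in> space (hyperplane_intensity \<phi> 1)"
      then obtain u t where H: "H = hyperplane u t" "u \<in> sphere 0 1"
        unfolding sp hyperplanes_def by blast
      obtain B :: nat where "\<bar>t\<bar> < real B" using reals_Archimedean2 by blast
      then have "(u, t) \<in> UNIV \<times> {- real B<..<real B}" by auto
      then have "H \<in> hyperplanes_of (UNIV \<times> {- real B<..<real B})"
        unfolding H(1) hyperplane_mem_hyperplanes_of[OF H(2)] by blast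
      then show "H \<in> \<Union>?\<A>" by blast
    qed
    show "\<forall>a\<in>?\<A>. emeasure (hyperplane_intensity \<phi> 1) a \<noteq> \<infinity>"
    proof
      fix a :: "'a set set" assume "a \<in> ?\<A>"
      then obtain B :: nat where "a = hyperplanes_of (UNIV \<times> {- real B<..<real B})" by blast
      then have "emeasure (hyperplane_intensity \<phi> 1) a \<le> ennreal (2 * real B)"
        using intensity_strip_le[OF \<phi>, of "real B"] by simp
      then show "emeasure (hyperplane_intensity \<phi> 1) a \<noteq> \<infinity>"
        by (auto simp: top_unique)
    qed
  qed auto
qed

lemma intensity_separating_finite:
  fixes \<phi> :: "'a::euclidean_space measure"
  assumes \<phi>: "sets \<phi> = sets sphere_borel" "prob_space \<phi>" and K: "k \<in> K" and \<eta>: "0 \<le> \<eta>"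
  shows "emeasure (hyperplane_intensity \<phi> 1) (hyperplanes_of (separating K y \<eta>)) < \<infinity>"
proof -
  let ?B = "norm k + norm y + 1"
  have op: "open ((UNIV :: 'a set) \<times> {- ?B<..<?B})" by (intro open_Times) auto
  have "hyperplanes_of (separating K y \<eta>) \<subseteq> hyperplanes_of (UNIV \<times> {- ?B<..<?B})"
  proof
    fix H assume "H \<in> hyperplanes_of (separating K y \<eta>)"
    then obtain u t where H: "H = hyperplane u t" "u \<in> sphere 0 1" "(u, t) \<in> separating K y \<eta>"
      unfolding hyperplanes_of_def by blast
    have "k \<bullet> u < t" "t < y \<bullet> u" using H(3) K \<eta> by (auto simp: separating_def)
    moreover have "\<bar>k \<bullet> u\<bar> \<le> norm k" "\<bar>y \<bullet> u\<bar> \<le> norm y"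
      using Cauchy_Schwarz_ineq2[of k u] Cauchy_Schwarz_ineq2[of y u] H(2) by simp_all
    ultimately have "t \<in> {- ?B<..<?B}"
      using norm_ge_zero[of k] norm_ge_zero[of y] by (auto simp: abs_le_iff)
    with H show "H \<in> hyperplanes_of (UNIV \<times> {- ?B<..<?B})"
      unfolding hyperplanes_of_def by blast
  qed
  then have "emeasure (hyperplane_intensity \<phi> 1) (hyperplanes_of (separating K y \<eta>)) \<le>
      emeasure (hyperplane_intensity \<phi> 1) (hyperplanes_of (UNIV \<times> {- ?B<..<?B}))"
    by (rule emeasure_mono) (unfold sets_hyperplane_intensity, rule sets_hyperplanes_of[OF op])
  also have "\<dots> \<le> ennreal (2 * ?B)" by (rule intensity_strip_le[OF \<phi>]) simp
  also have "\<dots> < \<infinity>" by simp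
  finally show ?thesis .
qed

text \<open>The intensity only integrates over \<open>t \<ge> 0\<close>. Halving the layer, at each \<open>u\<close> one half lies on
  one side of \<open>0\<close>; directions where it is the negative side are reflected, which
  is where evenness enters.\<close>

lemma intensity_ge_layer:
  fixes \<phi> :: "'a::euclidean_space measure"
  assumes \<phi>: "sets \<phi> = sets sphere_borel" and even: "even_measure \<phi>"
    and W: "open W" and h: "0 \<le> h"
    and layer: "\<And>u t. u \<in> sphere 0 1 \<inter> cball v \<rho> \<Longrightarrow> z \<bullet> u + s < t \<Longrightarrow> t < z \<bullet> u + s + h \<Longrightarrow> (u, t) \<in> W"
  shows "ennreal h * emeasure \<phi> (sphere 0 1 \<inter> cball v \<rho>) \<le>
    2 * emeasure (hyperplane_intensity \<phi> 1) (hyperplanes_of W)"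
proof -
  let ?\<Theta> = "emeasure (hyperplane_intensity \<phi> 1) (hyperplanes_of W)"
  let ?T = "\<lambda>u. {0..} \<inter> {t. (u, t) \<in> W \<or> (- u, - t) \<in> W}"
  define E where "E = sphere 0 1 \<inter> cball v \<rho> \<inter> {u. 0 \<le> z \<bullet> u + s + h / 2}"
  define F where "F = sphere 0 1 \<inter> cball v \<rho> \<inter> {u. z \<bullet> u + s + h / 2 \<le> 0}"
  have cl: "closed E" "closed F"
    unfolding E_def F_def by (intro closed_Int closed_Collect_le continuous_intros; simp)+
  have E: "E \<in> sets \<phi>" using cl(1) by (simp add: \<phi> sets_restrict_space_iff) (auto simp: E_def)
  have F: "F \<in> sets \<phi>" using cl(2) by (simp add: \<phi> sets_restrict_space_iff) (auto simp: F_def)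
  have F': "uminus ` F \<in> sets \<phi>"
    using closed_negations[OF cl(2)] by (simp add: \<phi> sets_restrict_space_iff) (auto simp: F_def)
  have Tm: "?T u \<in> sets lborel" for u
  proof -
    have "open ((\<lambda>t. (u, t)) -` W)" "open ((\<lambda>t. (- u, - t)) -` W)"
      by (intro open_vimage W continuous_intros)+
    then show ?thesis
      by (simp add: Collect_disj_eq vimage_def)
  qed
  \<comment> \<open>Half a layer suffices for the weight \<open>h\<close>, because of the factor 2
    in the intensity.\<close>
  have ge: "ennreal h * emeasure \<phi> G \<le> ?\<Theta>"
    if G: "G \<in> sets \<phi>" "\<And>u. u \<in> G \<Longrightarrow> ennreal (h / 2) \<le> emeasure lborel (?T u)" for G
  proof -
    have "ennreal (h / 2) * emeasure \<phi> G = (\<integral>\<^sup>+u. ennreal (h / 2) * indicator G u \<partial>\<phi>)"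
      using G(1) by (rule nn_integral_cmult_indicator[symmetric])
    also have "\<dots> \<le> (\<integral>\<^sup>+u. emeasure lborel (?T u) \<partial>\<phi>)"
      using G(2) by (intro nn_integral_mono) (simp add: indicator_def)
    finally have "2 * (ennreal (h / 2) * emeasure \<phi> G) \<le> ?\<Theta>"
      unfolding emeasure_intensity_hyperplanes_of[OF \<phi> W] by (rule mult_left_mono) simp
    moreover have "2 * ennreal (h / 2) = ennreal h"
      using h by (simp flip: ennreal_numeral ennreal_mult)
    ultimately show ?thesis by (simp add: mult.assoc[symmetric])
  qed
  have "ennreal h * emeasure \<phi> E \<le> ?\<Theta>"
  proof (rule ge[OF E])
    fix u assume "u \<in> E"
    then have u: "u \<in> sphere 0 1 \<inter> cball v \<rho>" "0 \<le> z \<bullet> u + s + h / 2" by (auto simp: E_def)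
    have "{z \<bullet> u + s + h / 2 <..< z \<bullet> u + s + h} \<subseteq> ?T u"
      using layer[OF u(1)] u(2) h by auto
    then have "emeasure lborel {z \<bullet> u + s + h / 2 <..< z \<bullet> u + s + h} \<le> emeasure lborel (?T u)"
      by (rule emeasure_mono) (rule Tm)
    then show "ennreal (h / 2) \<le> emeasure lborel (?T u)"
      using h by simp
  qed
  moreover have "ennreal h * emeasure \<phi> (uminus ` F) \<le> ?\<Theta>"
  proof (rule ge[OF F'])
    fix u assume "u \<in> uminus ` F"
    then have u: "- u \<in> sphere 0 1 \<inter> cball v \<rho>" "z \<bullet> (- u) + s + h / 2 \<le> 0" by (auto simp: F_def)
    have "{- (z \<bullet> (- u) + s + h / 2) <..< - (z \<bullet> (- u) + s)} \<subseteq> ?T u"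
      using layer[OF u(1)] u(2) h by auto
    then have "emeasure lborel {- (z \<bullet> (- u) + s + h / 2) <..< - (z \<bullet> (- u) + s)} \<le> emeasure lborel (?T u)"
      by (rule emeasure_mono) (rule Tm)
    then show "ennreal (h / 2) \<le> emeasure lborel (?T u)"
      using h by simp
  qed
  ultimately have "ennreal h * emeasure \<phi> E + ennreal h * emeasure \<phi> F \<le> 2 * ?\<Theta>"
    using even F unfolding even_measure_def mult_2 by (auto intro: add_mono)
  moreover have "emeasure \<phi> (sphere 0 1 \<inter> cball v \<rho>) \<le> emeasure \<phi> E + emeasure \<phi> F"
  proof -
    have "sphere 0 1 \<inter> cball v \<rho> = E \<union> F" by (auto simp: E_def F_def)
    then show ?thesis using emeasure_subadditive[OF E F] by simp
  qed
  then have "ennreal h * emeasure \<phi> (sphere 0 1 \<inter> cball v \<rho>) \<le> ennreal h * emeasure \<phi> E + ennreal h * emeasure \<phi> F"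
    unfolding distrib_left[symmetric] by (rule mult_left_mono) simp
  ultimately show ?thesis by (rule order_trans[rotated])
qed

text \<open>The slice over \<open>u\<close> can be nonempty for \<open>u\<close> near
  \<open>v\<close>, through the parameter \<open>(u, t)\<close>, and near \<open>- v\<close>,
  through \<open>(- u, - t)\<close>. Each case contributes an interval of length at most
  \<open>h\<close>, hence the two caps.\<close>

lemma intensity_le_layer:
  fixes \<phi> :: "'a::euclidean_space measure"
  assumes \<phi>: "sets \<phi> = sets sphere_borel" and W: "open W" and h: "0 \<le> h"
    and layer: "\<And>u t. u \<in> sphere 0 1 \<Longrightarrow> (u, t) \<in> W \<Longrightarrow>
      u \<in> cball v \<rho> \<and> z \<bullet> u < t \<and> t < z \<bullet> u + h"
  shows "emeasure (hyperplane_intensity \<phi> 1) (hyperplanes_of W) \<le>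
    2 * (ennreal h * (emeasure \<phi> (sphere 0 1 \<inter> cball v \<rho>) + emeasure \<phi> (sphere 0 1 \<inter> cball (- v) \<rho>)))"
proof -
  let ?T = "\<lambda>u. {0..} \<inter> {t. (u, t) \<in> W \<or> (- u, - t) \<in> W}"
  let ?C = "sphere 0 1 \<inter> cball v \<rho>" and ?D = "sphere 0 1 \<inter> cball (- v) \<rho>"
  have m: "?C \<in> sets \<phi>" "?D \<in> sets \<phi>" by (simp_all only: \<phi> cap_measurable)
  have "emeasure lborel (?T u) \<le> ennreal h * indicator ?C u + ennreal h * indicator ?D u"
    if "u \<in> space \<phi>" for u
  proof -
    have u: "u \<in> sphere 0 1" "- u \<in> sphere 0 1"
      using that sets_eq_imp_space_eq[OF \<phi>] by (simp_all add: space_restrict_space)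
    define A where "A = (if u \<in> ?C then {z \<bullet> u <..< z \<bullet> u + h} else {})"
    define B where "B = (if u \<in> ?D then {z \<bullet> u - h <..< z \<bullet> u} else {})"
    have "?T u \<subseteq> A \<union> B"
    proof
      fix t assume "t \<in> ?T u"
      then consider "(u, t) \<in> W" | "(- u, - t) \<in> W" by blast
      then show "t \<in> A \<union> B"
      proof cases
        case 1 then show ?thesis using layer[OF u(1) 1] u by (simp add: A_def)
      next
        case 2
        have "dist (- v) u = dist v (- u)" by (simp add: dist_norm norm_minus_commute add.commute)
        then show ?thesis using layer[OF u(2) 2] u by (auto simp: B_def)
      qed
    qed
    then have "emeasure lborel (?T u) \<le> emeasure lborel (A \<union> B)"
      by (rule emeasure_mono) (simp add: A_def B_def)
    also have "\<dots> \<le> emeasure lborel A + emeasure lborel B"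
      by (rule emeasure_subadditive) (simp_all add: A_def B_def)
    also have "\<dots> = ennreal h * indicator ?C u + ennreal h * indicator ?D u"
      using h by (simp add: A_def B_def indicator_def)
    finally show ?thesis .
  qed
  then have "(\<integral>\<^sup>+u. emeasure lborel (?T u) \<partial>\<phi>) \<le>
      (\<integral>\<^sup>+u. ennreal h * indicator ?C u + ennreal h * indicator ?D u \<partial>\<phi>)"
    by (rule nn_integral_mono)
  also have "\<dots> = (\<integral>\<^sup>+u. ennreal h * indicator ?C u \<partial>\<phi>) + (\<integral>\<^sup>+u. ennreal h * indicator ?D u \<partial>\<phi>)"
    using m by (intro nn_integral_add) simp_all
  also have "\<dots> = ennreal h * (emeasure \<phi> ?C + emeasure \<phi> ?D)"
    using m by (simp add: nn_integral_cmult_indicator distrib_left)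
  finally show ?thesis
    unfolding emeasure_intensity_hyperplanes_of[OF \<phi> W] by (rule mult_left_mono) simp
qed

text \<open>This is the case \<open>k = 0\<close> of the Poisson law; sigma-finiteness gives the
  product formula by which \<open>{0..real n} \<times> A\<close> has \<open>n\<close> times the
  intensity of \<open>A\<close>.\<close>

lemma void_probability:
  fixes \<phi> :: "'a::euclidean_space measure"
  assumes \<phi>: "sets \<phi> = sets sphere_borel" "prob_space \<phi>"
    and \<xi>: "poisson_hyperplane_driver P \<phi> \<xi>"
    and A: "A \<in> sets hyperplane_borel" "emeasure (hyperplane_intensity \<phi> 1) A < \<infinity>"
  shows "measure P {\<omega>\<in>space P. emeasure (\<xi> \<omega>) ({0..real n} \<times> A) = 0} =
    exp (- real n * measure (hyperplane_intensity \<phi> 1) A)"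
    and "{0..real n} \<times> A \<in> sets (restrict_space lborel {0..} \<Otimes>\<^sub>M hyperplane_intensity \<phi> 1)"
    and "{\<omega>\<in>space P. emeasure (\<xi> \<omega>) ({0..real n} \<times> A) = 0} \<in> sets P"
proof -
  let ?\<Lambda> = "restrict_space lborel {0..} \<Otimes>\<^sub>M hyperplane_intensity \<phi> 1"
  interpret sigma_finite_measure "hyperplane_intensity \<phi> 1"
    by (rule sigma_finite_intensity[OF \<phi>])
  have I: "{0..real n} \<in> sets (restrict_space lborel {0..})"
    by (simp add: sets_restrict_space_iff)
  have A': "A \<in> sets (hyperplane_intensity \<phi> 1)" by (simp add: sets_hyperplane_intensity A(1))
  show m: "{0..real n} \<times> A \<in> sets ?\<Lambda>" using I A' by (rule pair_measureI)
  have "emeasure ?\<Lambda> ({0..real n} \<times> A) = emeasure (restrict_space lborel {0..}) {0..real n} * emeasure (hyperplane_intensity \<phi> 1) A"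
    using I A' by (rule emeasure_pair_measure_Times)
  also have "emeasure (restrict_space lborel {0..}) {0..real n} = ennreal (real n)"
    by (subst emeasure_restrict_space) auto
  also have "emeasure (hyperplane_intensity \<phi> 1) A = ennreal (measure (hyperplane_intensity \<phi> 1) A)"
    using A(2) by (simp add: emeasure_eq_ennreal_measure less_top)
  also have "ennreal (real n) * \<dots> = ennreal (real n * measure (hyperplane_intensity \<phi> 1) A)"
    by (simp add: ennreal_mult)
  finally have e: "emeasure ?\<Lambda> ({0..real n} \<times> A) = ennreal (real n * measure (hyperplane_intensity \<phi> 1) A)" .
  then have m\<Lambda>: "measure ?\<Lambda> ({0..real n} \<times> A) = real n * measure (hyperplane_intensity \<phi> 1) A"
    by (simp add: measure_def)
  have "emeasure ?\<Lambda> ({0..real n} \<times> A) < \<infinity>" unfolding e by simp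
  with m \<xi> have "measure P {\<omega>\<in>space P. emeasure (\<xi> \<omega>) ({0..real n} \<times> A) = of_nat 0} =
      exp (- measure ?\<Lambda> ({0..real n} \<times> A)) * measure ?\<Lambda> ({0..real n} \<times> A) ^ 0 / fact 0"
    unfolding poisson_hyperplane_driver_def poisson_process_def by blast
  then show "measure P {\<omega>\<in>space P. emeasure (\<xi> \<omega>) ({0..real n} \<times> A) = 0} =
      exp (- real n * measure (hyperplane_intensity \<phi> 1) A)"
    by (simp add: m\<Lambda>)
  have "(\<lambda>\<omega>. emeasure (\<xi> \<omega>) ({0..real n} \<times> A)) \<in> borel_measurable P"
    using \<xi> m unfolding poisson_hyperplane_driver_def poisson_process_def by blast
  then show "{\<omega>\<in>space P. emeasure (\<xi> \<omega>) ({0..real n} \<times> A) = 0} \<in> sets P"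
    by measurable
qed

section \<open>Two-sided bounds for the intensity of separating sets\<close>

lemma intensity_separating_ge:
  fixes \<phi> :: "'a::euclidean_space measure"
  assumes \<phi>: "sets \<phi> = sets sphere_borel" "prob_space \<phi>" "even_measure \<phi>"
    and b: "0 < b" "\<And>A. A \<in> sets \<phi> \<Longrightarrow> ennreal b * emeasure sphere_lebesgue A \<le> emeasure \<phi> A"
    and K: "convex K" "compact K" "K \<noteq> {}"
    and sl: "slides_freely_inside K (cball x R)" and R: "0 < R"
  obtains c where "0 < c" "\<And>e y. 0 < e \<Longrightarrow> e \<le> R \<Longrightarrow> e \<le> infdist y K \<Longrightarrow>
    c * e powr ((real DIM('a) + 1) / 2) \<le>
      measure (hyperplane_intensity \<phi> 1) (hyperplanes_of (separating K y (e / 4)))"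
proof
  let ?d = "DIM('a)"
  define \<kappa> where "\<kappa> = unit_ball_vol (real ?d) / 8 ^ ?d"
  \<comment> \<open>The 8 is the layer height \<open>e / 4\<close> combined with the factor 2 lost
    in \<open>intensity_ge_layer\<close>; the square root comes from the cap radius.\<close>
  define c where "c = b * \<kappa> * sqrt (1 / (2 * R)) ^ (?d - 1) / 8"
  have \<kappa>: "0 < \<kappa>" by (simp add: \<kappa>_def)
  then show "0 < c" using b R by (simp add: c_def)
  fix e y assume e: "0 < e" "e \<le> R" "e \<le> infdist y K"
  let ?W = "separating K y (e / 4)"
  let ?\<theta> = "measure (hyperplane_intensity \<phi> 1) (hyperplanes_of ?W)"
  define \<rho> where "\<rho> = sqrt (e / (2 * R))"
  have \<rho>: "0 < \<rho>" "\<rho> \<le> 1" using e R by (simp_all add: \<rho>_def)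
  obtain k where k: "k \<in> K" using K(3) by blast
  have fin: "emeasure (hyperplane_intensity \<phi> 1) (hyperplanes_of ?W) = ennreal ?\<theta>"
    using intensity_separating_finite[OF \<phi>(1,2) k, of "e / 4" y] e
    by (simp add: emeasure_eq_ennreal_measure less_top)
  obtain v z s where v: "norm v = 1" and layer:
    "\<And>u t. u \<in> sphere 0 1 \<inter> cball v \<rho> \<Longrightarrow> z \<bullet> u + s < t \<Longrightarrow> t < z \<bullet> u + s + e / 4 \<Longrightarrow> (u, t) \<in> ?W"
    using separating_layer_inner[OF K sl R e] unfolding \<rho>_def by blast
  have cap: "sphere 0 1 \<inter> cball v \<rho> \<in> sets \<phi>" unfolding \<phi>(1) by (rule cap_measurable)
  have "ennreal (e / 4 * (b * (\<kappa> * \<rho> ^ (?d - 1)))) = ennreal (e / 4) * (ennreal b * ennreal (\<kappa> * \<rho> ^ (?d - 1)))"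
    using e b \<kappa> \<rho> by (simp flip: ennreal_mult)
  also have "\<dots> \<le> ennreal (e / 4) * (ennreal b * emeasure sphere_lebesgue (sphere 0 1 \<inter> cball v \<rho>))"
    using sphere_lebesgue_cap_ge[OF v \<rho>] unfolding \<kappa>_def by (intro mult_left_mono) auto
  also have "\<dots> \<le> ennreal (e / 4) * emeasure \<phi> (sphere 0 1 \<inter> cball v \<rho>)"
    using b(2)[OF cap] by (intro mult_left_mono) auto
  also have "\<dots> \<le> 2 * ennreal ?\<theta>"
    unfolding fin[symmetric]
    by (rule intensity_ge_layer[OF \<phi>(1,3) open_separating[OF K(2)] _ layer]) (use e in auto)
  also have "\<dots> = ennreal (2 * ?\<theta>)" by (simp add: ennreal_mult)
  finally have "e / 4 * (b * (\<kappa> * \<rho> ^ (?d - 1))) \<le> 2 * ?\<theta>"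
    by (simp add: ennreal_le_iff)
  moreover have "\<rho> ^ (?d - 1) = sqrt e ^ (?d - 1) * sqrt (1 / (2 * R)) ^ (?d - 1)"
    unfolding \<rho>_def by (simp add: real_sqrt_divide real_sqrt_mult power_divide power_mult_distrib)
  moreover have "e * sqrt e ^ (?d - 1) = e powr ((real ?d + 1) / 2)"
    using e(1) DIM_positive[where 'a='a] by (intro mult_sqrt_power_eq_powr) (auto simp: Suc_le_eq)
  moreover have "c * (e * sqrt e ^ (?d - 1)) =
      e / 4 * (b * (\<kappa> * (sqrt e ^ (?d - 1) * sqrt (1 / (2 * R)) ^ (?d - 1)))) / 2"
    by (simp add: c_def)
  ultimately show "c * e powr ((real ?d + 1) / 2) \<le> ?\<theta>"
    by simp
qed

lemma intensity_separating_le: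
  fixes \<phi> :: "'a::euclidean_space measure"
  assumes \<phi>: "sets \<phi> = sets sphere_borel" "prob_space \<phi>"
    and a: "0 < a" "\<And>A. A \<in> sets \<phi> \<Longrightarrow> emeasure \<phi> A \<le> ennreal a * emeasure sphere_lebesgue A"
    and K: "compact K" and r: "0 < r"
  obtains c where "0 < c" "\<And>e p v. 0 < e \<Longrightarrow> 2 * e \<le> r \<Longrightarrow> p \<in> K \<Longrightarrow> norm v = 1 \<Longrightarrow>
    cball (p - r *\<^sub>R v) r \<subseteq> K \<Longrightarrow>
    measure (hyperplane_intensity \<phi> 1) (hyperplanes_of (separating K (p + e *\<^sub>R v) 0)) \<le>
      c * e powr ((real DIM('a) + 1) / 2)"
proof
  let ?d = "DIM('a)"
  define \<kappa> where "\<kappa> = real ?d * unit_ball_vol (real ?d) * 2 ^ (?d + 1)"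
  \<comment> \<open>The 4 is the factor 2 of the intensity times the two antipodal caps.\<close>
  define c where "c = 4 * a * \<kappa> * sqrt (2 / r) ^ (?d - 1)"
  have \<kappa>: "0 < \<kappa>" by (simp add: \<kappa>_def)
  then show "0 < c" using a r by (simp add: c_def)
  fix e :: real and p v
  assume e: "0 < e" "2 * e \<le> r" and p: "p \<in> K" and v: "norm v = 1" and ball: "cball (p - r *\<^sub>R v) r \<subseteq> K"
  let ?W = "separating K (p + e *\<^sub>R v) 0"
  let ?\<theta> = "measure (hyperplane_intensity \<phi> 1) (hyperplanes_of ?W)"
  define \<rho> where "\<rho> = sqrt (2 * e / r)"
  have \<rho>: "0 < \<rho>" "\<rho> \<le> 1" using e r by (simp_all add: \<rho>_def)
  have fin: "emeasure (hyperplane_intensity \<phi> 1) (hyperplanes_of ?W) = ennreal ?\<theta>"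
    using intensity_separating_finite[OF \<phi>(1,2) p, of 0 "p + e *\<^sub>R v"]
    by (simp add: emeasure_eq_ennreal_measure less_top)
  have cap: "emeasure \<phi> (sphere 0 1 \<inter> cball w \<rho>) \<le> ennreal (a * (\<kappa> * \<rho> ^ (?d - 1)))" if w: "norm w = 1" for w
  proof -
    have "sphere 0 1 \<inter> cball w \<rho> \<in> sets \<phi>" unfolding \<phi>(1) by (rule cap_measurable)
    then have "emeasure \<phi> (sphere 0 1 \<inter> cball w \<rho>) \<le> ennreal a * emeasure sphere_lebesgue (sphere 0 1 \<inter> cball w \<rho>)"
      by (rule a(2))
    also have "\<dots> \<le> ennreal a * ennreal (\<kappa> * \<rho> ^ (?d - 1))"
      using sphere_lebesgue_cap_le[OF w \<rho>] unfolding \<kappa>_def by (intro mult_left_mono) auto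
    finally show ?thesis using a \<kappa> \<rho> by (simp add: ennreal_mult)
  qed
  have layer: "u \<in> cball v \<rho> \<and> p \<bullet> u < t \<and> t < p \<bullet> u + e" if "u \<in> sphere 0 1" "(u, t) \<in> ?W" for u t
    using separating_layer_outer[OF r p v ball e(1) _ that(2)] that(1)
    by (simp add: \<rho>_def dist_norm norm_minus_commute)
  have "ennreal ?\<theta> \<le> 2 * (ennreal e * (emeasure \<phi> (sphere 0 1 \<inter> cball v \<rho>) + emeasure \<phi> (sphere 0 1 \<inter> cball (- v) \<rho>)))"
    unfolding fin[symmetric]
    by (rule intensity_le_layer[OF \<phi>(1) open_separating[OF K] _ layer]) (use e in auto)
  also have "\<dots> \<le> 2 * (ennreal e * (ennreal (a * (\<kappa> * \<rho> ^ (?d - 1))) + ennreal (a * (\<kappa> * \<rho> ^ (?d - 1)))))"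
    using cap[of v] cap[of "- v"] v by (intro mult_left_mono add_mono) auto
  also have "\<dots> = ennreal (2 * (e * (a * (\<kappa> * \<rho> ^ (?d - 1)) + a * (\<kappa> * \<rho> ^ (?d - 1)))))"
    using e a \<kappa> \<rho> by (simp flip: ennreal_mult ennreal_plus ennreal_numeral)
  finally have "?\<theta> \<le> 2 * (e * (a * (\<kappa> * \<rho> ^ (?d - 1)) + a * (\<kappa> * \<rho> ^ (?d - 1))))"
    by (rule ennreal_le_iff[THEN iffD1, rotated]) (use e a \<kappa> \<rho> in simp)
  moreover have "\<rho> ^ (?d - 1) = sqrt e ^ (?d - 1) * sqrt (2 / r) ^ (?d - 1)"
    unfolding \<rho>_def by (simp add: real_sqrt_divide real_sqrt_mult power_divide power_mult_distrib)
  moreover have "e * sqrt e ^ (?d - 1) = e powr ((real ?d + 1) / 2)"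
    using e(1) DIM_positive[where 'a='a] by (intro mult_sqrt_power_eq_powr) (auto simp: Suc_le_eq)
  moreover have "c * (e * sqrt e ^ (?d - 1)) =
      4 * (e * (a * (\<kappa> * (sqrt e ^ (?d - 1) * sqrt (2 / r) ^ (?d - 1)))))"
    by (simp add: c_def)
  ultimately show "?\<theta> \<le> c * e powr ((real ?d + 1) / 2)"
    by (simp add: mult_ac)
qed

lemma no_void_probability:
  fixes \<phi> :: "'a::euclidean_space measure" and A :: "nat \<Rightarrow> 'a set set"
  assumes \<phi>: "sets \<phi> = sets sphere_borel" "prob_space \<phi>"
    and P: "prob_space P" and \<xi>: "poisson_hyperplane_driver P \<phi> \<xi>"
    and A: "\<And>i. i < m \<Longrightarrow> A i \<in> sets hyperplane_borel"
      "\<And>i. i < m \<Longrightarrow> emeasure (hyperplane_intensity \<phi> 1) (A i) < \<infinity>"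
    and disj: "disjoint_family_on A {..<m}" and m: "0 < m"
  shows "measure P {\<omega>\<in>space P. \<forall>i<m. emeasure (\<xi> \<omega>) ({0..real n} \<times> A i) \<noteq> 0} =
    (\<Prod>i<m. 1 - exp (- real n * measure (hyperplane_intensity \<phi> 1) (A i)))"
proof -
  interpret prob_space P by fact
  let ?X = "\<lambda>i \<omega>. emeasure (\<xi> \<omega>) ({0..real n} \<times> A i)"
  let ?\<Lambda> = "restrict_space lborel {0..} \<Otimes>\<^sub>M hyperplane_intensity \<phi> 1"
  note void = void_probability[OF \<phi> \<xi> A(1) A(2)]
  have A_sets: "(\<lambda>i. {0..real n} \<times> A i) ` {..<m} \<subseteq> sets ?\<Lambda>"
    using void(2) by auto
  have A_disj: "disjoint_family_on (\<lambda>i. {0..real n} \<times> A i) {..<m}"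
    using disj unfolding disjoint_family_on_def by blast
  have indep: "\<forall>(B::nat \<Rightarrow> (real \<times> 'a set) set) m. B ` {..<m} \<subseteq> sets ?\<Lambda> \<and> disjoint_family_on B {..<m} \<longrightarrow>
      indep_vars (\<lambda>_. borel) (\<lambda>i \<omega>. emeasure (\<xi> \<omega>) (B i)) {..<m}"
    using \<xi> unfolding poisson_hyperplane_driver_def poisson_process_def by (elim conjE)
  have "indep_vars (\<lambda>_. borel) ?X {..<m}"
    by (rule mp[OF spec[OF spec[OF indep, of "\<lambda>i. {0..real n} \<times> A i"], of m] conjI[OF A_sets A_disj]])
  then have "prob (\<Inter>i\<in>{..<m}. ?X i -` (- {0}) \<inter> space P) = (\<Prod>i\<in>{..<m}. prob (?X i -` (- {0}) \<inter> space P))"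
    by (rule indep_varsD_finite) (use m in auto)
  also have "(\<Inter>i\<in>{..<m}. ?X i -` (- {0}) \<inter> space P) = {\<omega>\<in>space P. \<forall>i<m. ?X i \<omega> \<noteq> 0}"
    using m by auto
  also have "(\<Prod>i\<in>{..<m}. prob (?X i -` (- {0}) \<inter> space P)) =
      (\<Prod>i<m. 1 - exp (- real n * measure (hyperplane_intensity \<phi> 1) (A i)))"
  proof (rule prod.cong[OF refl])
    fix i assume "i \<in> {..<m}"
    then have i: "i < m" by simp
    have "?X i -` (- {0}) \<inter> space P = space P - {\<omega>\<in>space P. ?X i \<omega> = 0}" by auto
    then have "prob (?X i -` (- {0}) \<inter> space P) = 1 - prob {\<omega>\<in>space P. ?X i \<omega> = 0}"
      using prob_compl[OF void(3)[OF i i]] by simp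
    then show "prob (?X i -` (- {0}) \<inter> space P) = 1 - exp (- real n * measure (hyperplane_intensity \<phi> 1) (A i))"
      using void(1)[OF i i] by simp
  qed
  finally show ?thesis .
qed

text \<open>A common hyperplane has equal or opposite parameters in the two sets. If equal, its
  normal is within \<open>sqrt (2 * e / r)\<close> of both \<open>v\<close> and \<open>w\<close>,
  which are too far apart. If opposite, \<open>p\<close> would lie strictly on both sides of
  it.\<close>

lemma disjoint_hyperplanes_of_separating:
  fixes K :: "'a::euclidean_space set"
  assumes r: "0 < r" and e: "0 < e" and pq: "p \<in> K" "q \<in> K" and vw: "norm v = 1" "norm w = 1"
    and balls: "cball (p - r *\<^sub>R v) r \<subseteq> K" "cball (q - r *\<^sub>R w) r \<subseteq> K"
    and far: "2 * sqrt (2 * e / r) < norm (v - w)"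
  shows "hyperplanes_of (separating K (p + e *\<^sub>R v) 0) \<inter> hyperplanes_of (separating K (q + e *\<^sub>R w) 0) = {}"
proof (rule equals0I)
  fix H assume H: "H \<in> hyperplanes_of (separating K (p + e *\<^sub>R v) 0) \<inter> hyperplanes_of (separating K (q + e *\<^sub>R w) 0)"
  obtain u t where u: "H = hyperplane u t" "norm u = 1" "(u, t) \<in> separating K (p + e *\<^sub>R v) 0"
    using IntD1[OF H] unfolding hyperplanes_of_def by auto
  obtain u' t' where u': "H = hyperplane u' t'" "norm u' = 1" "(u', t') \<in> separating K (q + e *\<^sub>R w) 0"
    using IntD2[OF H] unfolding hyperplanes_of_def by auto
  have *: "norm (u - v) \<le> sqrt (2 * e / r)" "norm (u' - w) \<le> sqrt (2 * e / r)"
    using separating_layer_outer(1)[OF r pq(1) vw(1) balls(1) e u(2,3)]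
      separating_layer_outer(1)[OF r pq(2) vw(2) balls(2) e u'(2,3)] .
  have pt: "p \<bullet> u < t" "p \<bullet> u' < t'" using u(3) u'(3) pq by (auto simp: separating_def)
  have "(u', t') = (u, t) \<or> (u', t') = (- u, - t)"
    using hyperplane_eqD[of u t u' t'] u u' by simp
  then show False
  proof
    assume "(u', t') = (u, t)"
    then have "norm (v - w) \<le> norm (u - v) + norm (u' - w)"
      using norm_triangle_ineq4[of "u - w" "u - v"] by simp
    with * far show False by linarith
  next
    assume "(u', t') = (- u, - t)"
    with pt show False by simp
  qed
qed

text \<open>Intermediate value theorem for the distance along the segment from \<open>k\<close> to
  \<open>x\<close>. It pulls a far point of the cell back to one prescribed scale.\<close>

lemma convex_exists_infdist_eq:
  fixes K Z :: "'a::euclidean_space set"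
  assumes Z: "convex Z" "K \<subseteq> Z" "k \<in> K" and x: "x \<in> Z" "\<delta> \<le> infdist x K" and \<delta>: "0 \<le> \<delta>"
  obtains x' where "x' \<in> Z" "infdist x' K = \<delta>"
proof -
  let ?g = "\<lambda>s. (1 - s) *\<^sub>R k + s *\<^sub>R x"
  have "\<exists>s\<ge>0. s \<le> 1 \<and> infdist (?g s) K = \<delta>"
  proof (rule IVT')
    show "infdist (?g 0) K \<le> \<delta>" using Z(3) \<delta> by simp
    show "\<delta> \<le> infdist (?g 1) K" using x by simp
    show "continuous_on {0..1} (\<lambda>s. infdist (?g s) K)" by (intro continuous_intros)
  qed simp
  then obtain s where s: "0 \<le> s" "s \<le> 1" "infdist (?g s) K = \<delta>" by blast
  have "?g s \<in> Z" using Z x s by (intro convexD_alt) auto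
  then show ?thesis using s(3) by (rule that)
qed

section \<open>Nets and asymptotics\<close>

text \<open>The net is a grid of mesh \<open>1 / (n * d)\<close>: rounding costs at most one mesh
  width in each of \<open>d\<close> coordinates, in total \<open>1 / n\<close>.\<close>

lemma finite_net_polynomial:
  fixes S :: "'a::euclidean_space set"
  assumes "bounded S"
  obtains M N where "0 < M" "\<And>n::nat. finite (N n)"
    "\<And>n::nat. n \<ge> 1 \<Longrightarrow> real (card (N n)) \<le> M * real n ^ DIM('a)"
    "\<And>n x. n \<ge> 1 \<Longrightarrow> x \<in> S \<Longrightarrow> \<exists>y\<in>N n. dist x y \<le> 1 / real n"
proof -
  let ?d = "DIM('a)"
  obtain B' where B': "\<And>x. x \<in> S \<Longrightarrow> norm x \<le> B'"
    using assms unfolding bounded_iff by blast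
  obtain B :: nat where "B' \<le> real B" using real_arch_simple by blast
  with B' have B: "norm x \<le> real B" if "x \<in> S" for x using that by (meson order_trans)
  \<comment> \<open>\<open>Suc B\<close> instead of \<open>B\<close> leaves room for rounding down
    at the lower end.\<close>
  define L where "L n = int (Suc B * n * ?d)" for n
  define G where "G n = (PiE Basis (\<lambda>_. {- L n..L n}) :: ('a \<Rightarrow> int) set)" for n
  define pt where "pt n g = (\<Sum>b\<in>Basis. (of_int (g b) / (real n * real ?d)) *\<^sub>R b)" for n :: nat and g :: "'a \<Rightarrow> int"
  define N where "N n = pt n ` G n" for n
  show ?thesis
  proof
    show "0 < (3 * real (Suc B) * real ?d) ^ ?d" by simp
    fix n :: nat
    have finG: "finite (G n)" by (auto simp: G_def intro: finite_PiE)
    then show "finite (N n)" by (simp add: N_def)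
    assume n: "n \<ge> 1"
    have L1: "1 \<le> L n" using n by (simp add: L_def Suc_le_eq flip: of_nat_mult)
    have "card (N n) \<le> card (G n)" unfolding N_def by (rule card_image_le[OF finG])
    also have "\<dots> = (nat (2 * L n + 1)) ^ ?d"
      unfolding G_def by (subst card_PiE) (auto simp: algebra_simps)
    finally have "real (card (N n)) \<le> real (nat (2 * L n + 1)) ^ ?d"
      by (metis of_nat_le_iff of_nat_power)
    also have "real (nat (2 * L n + 1)) \<le> 3 * real_of_int (L n)" using L1 by simp
    then have "real (nat (2 * L n + 1)) ^ ?d \<le> (3 * real_of_int (L n)) ^ ?d"
      by (rule power_mono) simp
    also have "3 * real_of_int (L n) = (3 * real (Suc B) * real ?d) * real n"
      by (simp add: L_def algebra_simps)
    finally show "real (card (N n)) \<le> (3 * real (Suc B) * real ?d) ^ ?d * real n ^ ?d"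
      by (simp add: power_mult_distrib)
    fix x assume x: "x \<in> S"
    let ?q = "real n * real ?d"
    have q: "0 < ?q" using n by simp
    define g where "g = restrict (\<lambda>b. \<lfloor>(x \<bullet> b) * ?q\<rfloor>) Basis"
    have "g \<in> G n"
      unfolding G_def g_def
    proof (rule restrict_PiE_iff[THEN iffD2], intro ballI)
      fix b :: 'a assume b: "b \<in> Basis"
      have "\<bar>x \<bullet> b\<bar> \<le> real B" using Basis_le_norm[OF b, of x] B[OF x] by linarith
      then have "\<bar>x \<bullet> b\<bar> * ?q \<le> real B * ?q" using q by (intro mult_right_mono) auto
      then have "\<bar>(x \<bullet> b) * ?q\<bar> \<le> real B * ?q" using q by (simp add: abs_mult)
      moreover have "real_of_int (L n) = real B * ?q + ?q" by (simp add: L_def algebra_simps)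
      moreover have "1 \<le> ?q" using n DIM_positive[where 'a='a] by (simp add: Suc_le_eq flip: of_nat_mult)
      ultimately show "\<lfloor>(x \<bullet> b) * ?q\<rfloor> \<in> {- L n..L n}"
        by (simp add: le_floor_iff floor_le_iff abs_le_iff)
    qed
    moreover have "dist x (pt n g) \<le> 1 / real n"
    proof -
      have "x - pt n g = (\<Sum>b\<in>Basis. (x \<bullet> b - of_int \<lfloor>(x \<bullet> b) * ?q\<rfloor> / ?q) *\<^sub>R b)"
        by (simp add: pt_def g_def scaleR_diff_left sum_subtractf euclidean_representation)
      then have "dist x (pt n g) = norm (\<Sum>b\<in>Basis. (x \<bullet> b - of_int \<lfloor>(x \<bullet> b) * ?q\<rfloor> / ?q) *\<^sub>R b)"
        by (simp only: dist_norm)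
      also have "\<dots> \<le> (\<Sum>b\<in>Basis. norm ((x \<bullet> b - of_int \<lfloor>(x \<bullet> b) * ?q\<rfloor> / ?q) *\<^sub>R b))"
        by (rule norm_sum)
      also have "\<dots> \<le> (\<Sum>b\<in>(Basis::'a set). 1 / ?q)"
      proof (rule sum_mono)
        fix b :: 'a assume b: "b \<in> Basis"
        have "x \<bullet> b - of_int \<lfloor>(x \<bullet> b) * ?q\<rfloor> / ?q = ((x \<bullet> b) * ?q - of_int \<lfloor>(x \<bullet> b) * ?q\<rfloor>) / ?q"
          using n by (simp add: diff_divide_distrib)
        moreover have "\<bar>(x \<bullet> b) * ?q - of_int \<lfloor>(x \<bullet> b) * ?q\<rfloor>\<bar> \<le> 1" by linarith
        ultimately show "norm ((x \<bullet> b - of_int \<lfloor>(x \<bullet> b) * ?q\<rfloor> / ?q) *\<^sub>R b) \<le> 1 / ?q"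
          using q b by (simp add: divide_right_mono)
      qed
      also have "\<dots> = 1 / real n" using n by simp
      finally show ?thesis .
    qed
    ultimately show "\<exists>y\<in>N n. dist x y \<le> 1 / real n" by (auto simp: N_def)
  qed
qed

lemma rate_tendsto_0:
  assumes "0 < \<beta>"
  shows "(\<lambda>n::nat. (ln (real n) / real n) powr \<beta>) \<longlonglongrightarrow> 0"
proof (rule tendsto_zero_powrI[OF lim_ln_over_n tendsto_const _ assms])
  show "eventually (\<lambda>n::nat. 0 \<le> ln (real n) / real n) sequentially"
    using eventually_ge_at_top[of 1] by eventually_elim simp
qed

text \<open>The product \<open>real n powr \<beta> * (ln (real n) / real n) powr (2 *
  \<beta>)\<close> is \<open>((ln n)\<^sup>2 / n) powr \<beta>\<close>. In the application it is the
  number of normals times the order of the cap radius; the \<open>+ 1\<close> pays for rounding that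
  number up.\<close>

lemma rate_times_tendsto_0:
  assumes "0 < \<beta>"
  shows "(\<lambda>n::nat. (real n powr \<beta> + 1) * (ln (real n) / real n) powr (2 * \<beta>)) \<longlonglongrightarrow> 0"
proof -
  have "(\<lambda>n::nat. (ln (real n) / real n powr (1 / 2)) * (ln (real n) / real n powr (1 / 2))) \<longlonglongrightarrow> 0 * 0"
    by (intro tendsto_mult lim_ln_over_power) auto
  then have "(\<lambda>n::nat. ((ln (real n) / real n powr (1 / 2)) * (ln (real n) / real n powr (1 / 2))) powr \<beta>) \<longlonglongrightarrow> 0"
    by (intro tendsto_zero_powrI[OF _ tendsto_const _ assms]) auto
  moreover have "eventually (\<lambda>n::nat. ((ln (real n) / real n powr (1 / 2)) * (ln (real n) / real n powr (1 / 2))) powr \<beta> =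
      real n powr \<beta> * (ln (real n) / real n) powr (2 * \<beta>)) sequentially"
    using eventually_gt_at_top[of 1]
  proof eventually_elim
    case (elim n)
    have "real n powr (1 / 2) * real n powr (1 / 2) = real n"
      using elim by (simp flip: powr_add)
    then have "(ln (real n) / real n powr (1 / 2)) * (ln (real n) / real n powr (1 / 2)) =
        real n * (ln (real n) / real n) powr 2"
      using elim by (simp add: power2_eq_square)
    then show ?case
      using elim by (simp only: powr_mult powr_powr)
  qed
  ultimately have "(\<lambda>n::nat. real n powr \<beta> * (ln (real n) / real n) powr (2 * \<beta>)) \<longlonglongrightarrow> 0"
    by (rule Lim_transform_eventually)
  moreover have "(\<lambda>n::nat. (ln (real n) / real n) powr (2 * \<beta>)) \<longlonglongrightarrow> 0"
    using assms by (intro rate_tendsto_0) simp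
  ultimately have "(\<lambda>n::nat. real n powr \<beta> * (ln (real n) / real n) powr (2 * \<beta>) +
      (ln (real n) / real n) powr (2 * \<beta>)) \<longlonglongrightarrow> 0 + 0"
    by (rule tendsto_add)
  then show ?thesis by (simp add: distrib_right)
qed

text \<open>Compares the mesh of the net with the rate; \<open>3 \<le> n\<close> ensures
  \<open>1 \<le> ln n\<close>.\<close>

lemma inverse_le_rate:
  assumes "0 < \<beta>" "\<beta> \<le> 1" "3 \<le> n"
  shows "1 / real n \<le> (ln (real n) / real n) powr \<beta>"
proof -
  have "exp 1 \<le> real n" using exp_le assms(3) by linarith
  then have "1 \<le> ln (real n)" using assms(3) by (simp add: ln_ge_iff)
  then have "1 / real n \<le> ln (real n) / real n" by (rule divide_right_mono) simp
  also have "\<dots> = (ln (real n) / real n) powr 1" using \<open>1 \<le> ln (real n)\<close> by simp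
  also have "\<dots> \<le> (ln (real n) / real n) powr \<beta>"
    using assms \<open>1 \<le> ln (real n)\<close> ln_bound[of "real n"] by (intro powr_mono') auto
  finally show ?thesis .
qed

lemma summable_exp_neg_powr:
  assumes "0 < \<gamma>"
  shows "summable (\<lambda>n::nat. exp (- (real n powr \<gamma>)))"
proof (rule summable_comparison_test_ev)
  have "eventually (\<lambda>n::nat. ln (real n) / real n powr \<gamma> < 1 / 2) sequentially"
    using assms by (intro order_tendstoD(2)[OF lim_ln_over_power]) auto
  with eventually_gt_at_top[of 0]
  show "eventually (\<lambda>n::nat. norm (exp (- (real n powr \<gamma>))) \<le> 1 / real n ^ 2) sequentially"
  proof eventually_elim
    case (elim n)
    then have "2 * ln (real n) \<le> real n powr \<gamma>" by (simp add: field_simps)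
    then have "exp (- (real n powr \<gamma>)) \<le> exp (- (2 * ln (real n)))" by simp
    also have "\<dots> = 1 / real n ^ 2"
      using elim by (simp add: exp_minus exp_double inverse_eq_divide)
    finally show ?case by simp
  qed
  show "summable (\<lambda>n::nat. 1 / real n ^ 2)"
    using inverse_power_summable[of 2, where 'a=real] by (simp add: inverse_eq_divide)
qed

section \<open>Almost sure order of the distance\<close>

abbreviation (input) rate :: "nat \<Rightarrow> nat \<Rightarrow> real" where
  "rate d n \<equiv> (ln (real n) / real n) powr (2 / (real d + 1))"

text \<open>At distance of the order of the rate, the intensity up to time \<open>n\<close> is thus
  of order \<open>ln n\<close>, and void probabilities become powers of \<open>n\<close>.\<close>

lemma rate_powr:
  assumes "1 \<le> n"
  shows "rate d n powr ((real d + 1) / 2) = ln (real n) / real n"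
proof -
  have eq: "2 / (real d + 1) * ((real d + 1) / 2) = 1" by (simp add: field_simps)
  show ?thesis unfolding powr_powr eq using assms by simp
qed

lemma exp_neg_mult_ln:
  assumes "1 \<le> n"
  shows "exp (- (real k * ln (real n))) = 1 / real n ^ k"
proof -
  have "exp (real k * ln (real n)) = real n ^ k"
    using assms by (simp add: exp_of_nat_mult)
  then show ?thesis by (simp add: exp_minus inverse_eq_divide)
qed

locale poisson_K_cell =
  fixes K :: "'a::euclidean_space set" and \<phi> :: "'a measure" and a b :: real
    and P :: "'w measure" and \<xi> :: "'w \<Rightarrow> (real \<times> 'a set) measure"
  assumes dim: "DIM('a) \<ge> 2"
    and K: "convex K" "compact K" "K \<noteq> {}"
    and inner_ball: "\<exists>x r. r > 0 \<and> slides_freely_inside (cball x r) K"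
    and outer_ball: "\<exists>x R. R > 0 \<and> slides_freely_inside K (cball x R)"
    and \<phi>: "sets \<phi> = sets sphere_borel" "prob_space \<phi>" "even_measure \<phi>"
    and a: "0 < a" "\<And>A. A \<in> sets \<phi> \<Longrightarrow> emeasure \<phi> A \<le> ennreal a * emeasure sphere_lebesgue A"
    and b: "0 < b" "\<And>A. A \<in> sets \<phi> \<Longrightarrow> ennreal b * emeasure sphere_lebesgue A \<le> emeasure \<phi> A"
    and P: "prob_space P" and \<xi>: "poisson_hyperplane_driver P \<phi> \<xi>"
begin

text \<open>For \<open>\<eta> = 0\<close> this is the event that \<open>y\<close> lies in the cell.
  For larger \<open>\<eta>\<close> the event grows, and it contains the event that a given point
  within \<open>\<eta>\<close> of \<open>y\<close> lies in the cell.\<close>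

abbreviation missed :: "nat \<Rightarrow> 'a \<Rightarrow> real \<Rightarrow> 'w set" where
  "missed n y \<eta> \<equiv>
    {\<omega>\<in>space P. emeasure (\<xi> \<omega>) ({0..real n} \<times> hyperplanes_of (separating K y \<eta>)) = 0}"

abbreviation intensity :: "'a \<Rightarrow> real \<Rightarrow> real" where
  "intensity y \<eta> \<equiv> measure (hyperplane_intensity \<phi> 1) (hyperplanes_of (separating K y \<eta>))"

lemma missed:
  assumes "0 \<le> \<eta>"
  shows measure_missed: "measure P (missed n y \<eta>) = exp (- real n * intensity y \<eta>)"
    and sets_missed: "missed n y \<eta> \<in> sets P"
    and sets_separated: "{0..real n} \<times> hyperplanes_of (separating K y \<eta>) \<in>
      sets (restrict_space lborel {0..} \<Otimes>\<^sub>M hyperplane_intensity \<phi> 1)"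
proof -
  obtain k where k: "k \<in> K" using K(3) by blast
  note * = void_probability[OF \<phi>(1,2) \<xi> sets_hyperplanes_of[OF open_separating[OF K(2)]]
    intensity_separating_finite[OF \<phi>(1,2) k assms]]
  show "measure P (missed n y \<eta>) = exp (- real n * intensity y \<eta>)" by (rule *(1))
  show "missed n y \<eta> \<in> sets P" by (rule *(3))
  show "{0..real n} \<times> hyperplanes_of (separating K y \<eta>) \<in>
      sets (restrict_space lborel {0..} \<Otimes>\<^sub>M hyperplane_intensity \<phi> 1)" by (rule *(2))
qed

lemma sets_driver:
  assumes "\<omega> \<in> space P"
  shows "sets (\<xi> \<omega>) = sets (restrict_space lborel {0..} \<Otimes>\<^sub>M hyperplane_intensity \<phi> 1)"
  using \<xi> assms unfolding poisson_hyperplane_driver_def poisson_process_def by blast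

lemma mem_process_cell_iff_missed:
  assumes "\<omega> \<in> space P"
  shows "x \<in> process_cell K \<xi> n \<omega> \<longleftrightarrow> \<omega> \<in> missed n x 0"
  using mem_process_cell_iff[where \<xi>=\<xi> and \<omega>=\<omega>, OF sets_driver[OF assms] K(2)] assms by simp

text \<open>For a unit vector \<open>u\<close>, passing from \<open>y\<close> to \<open>x\<close>
  lowers the inner product by at most \<open>\<eta>\<close>, which the slack absorbs. This transfers
  cell points to net points.\<close>

lemma missed_mono:
  assumes \<omega>: "\<omega> \<in> missed n x 0" and xy: "dist x y \<le> \<eta>"
  shows "\<omega> \<in> missed n y \<eta>"
proof -
  have sp: "\<omega> \<in> space P" using \<omega> by simp
  have "hyperplanes_of (separating K y \<eta>) \<subseteq> hyperplanes_of (separating K x 0)"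
  proof
    fix H assume "H \<in> hyperplanes_of (separating K y \<eta>)"
    then obtain u t where H: "H = hyperplane u t" "u \<in> sphere 0 1" "(u, t) \<in> separating K y \<eta>"
      unfolding hyperplanes_of_def by blast
    have "(y - x) \<bullet> u \<le> norm (y - x) * norm u" by (rule norm_cauchy_schwarz)
    then have "y \<bullet> u - \<eta> \<le> x \<bullet> u"
      using xy H(2) by (simp add: inner_simps dist_norm norm_minus_commute)
    with H(3) have "(u, t) \<in> separating K x 0" by (auto simp: separating_def)
    with H(1,2) show "H \<in> hyperplanes_of (separating K x 0)"
      unfolding hyperplanes_of_def by blast
  qed
  then have "emeasure (\<xi> \<omega>) ({0..real n} \<times> hyperplanes_of (separating K y \<eta>)) \<le>
      emeasure (\<xi> \<omega>) ({0..real n} \<times> hyperplanes_of (separating K x 0))"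
    by (intro emeasure_mono) (auto simp: sets_driver[OF sp] sets_separated)
  then show ?thesis using \<omega> by simp
qed

lemma rate_eventually_less:
  assumes "0 < \<epsilon>"
  shows "eventually (\<lambda>n. rate DIM('a) n < \<epsilon>) sequentially"
  by (intro order_tendstoD(2)[OF rate_tendsto_0 assms]) simp

section \<open>Upper bound: union bound over a net\<close>

lemma cell_upper_bound:
  obtains C where "0 < C"
    "AE \<omega> in P. eventually (\<lambda>n. \<forall>x\<in>process_cell K \<xi> n \<omega>. infdist x K \<le> C * rate DIM('a) n) sequentially"
proof -
  interpret prob_space P by (rule P)
  let ?d = "DIM('a)"
  obtain x\<^sub>0 R where R: "0 < R" "slides_freely_inside K (cball x\<^sub>0 R)" using outer_ball by blast
  obtain c where c: "0 < c" and int_ge: "\<And>e y. 0 < e \<Longrightarrow> e \<le> R \<Longrightarrow> e \<le> infdist y K \<Longrightarrow>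
      c * e powr ((real ?d + 1) / 2) \<le> intensity y (e / 4)"
    using intensity_separating_ge[OF \<phi> b K R(2,1)] by blast
  \<comment> \<open>\<open>C \<ge> 4\<close> keeps the mesh \<open>1 / n\<close> below
    \<open>e n / 4\<close>. The other term makes each void probability at most
    \<open>n ^ -(d + 2)\<close>, so that about \<open>n ^ d\<close> net points leave the summable
    \<open>n ^ -2\<close>.\<close>
  define C where "C = max 4 (real (?d + 2) / c)"
  have C: "4 \<le> C" "real (?d + 2) \<le> c * C"
  proof -
    have "real (?d + 2) / c \<le> C" by (simp add: C_def)
    then show "real (?d + 2) \<le> c * C" using c by (simp add: field_simps)
  qed (simp add: C_def)
  define e where "e n = C * rate DIM('a) n" for n
  have e0: "0 \<le> e n" for n using C by (simp add: e_def)
  define S where "S = {x. infdist x K \<le> 1}"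
  have "bounded S"
  proof -
    obtain B where B: "\<And>k. k \<in> K \<Longrightarrow> norm k \<le> B"
      using compact_imp_bounded[OF K(2)] unfolding bounded_iff by blast
    have "norm x \<le> B + 1" if "x \<in> S" for x
    proof -
      obtain k where k: "k \<in> K" "infdist x K = dist x k"
        using infdist_attains_inf[OF compact_imp_closed[OF K(2)] K(3)] by blast
      have "norm x \<le> norm k + dist x k"
        using norm_triangle_ineq[of k "x - k"] by (simp add: dist_norm)
      then show ?thesis using B[OF k(1)] k(2) that by (simp add: S_def)
    qed
    then show ?thesis unfolding bounded_iff by blast
  qed
  then obtain M and N :: "nat \<Rightarrow> 'a set" where M: "0 < M" and N: "\<And>n. finite (N n)"
    "\<And>n. n \<ge> 1 \<Longrightarrow> real (card (N n)) \<le> M * real n ^ ?d"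
    "\<And>n x. n \<ge> 1 \<Longrightarrow> x \<in> S \<Longrightarrow> \<exists>y\<in>N n. dist x y \<le> 1 / real n"
    using finite_net_polynomial by metis
  define N' where "N' n = N n \<inter> {y. e n \<le> infdist y K}" for n
  have N': "finite (N' n)" for n using N(1) by (simp add: N'_def)
  define Bad where "Bad n = (\<Union>y\<in>N' n. missed n y (e n / 4))" for n
  have Bad_sets: "Bad n \<in> sets P" for n
    unfolding Bad_def using N' e0[of n] by (intro sets.finite_UN) (auto intro: sets_missed)
  have ev: "eventually (\<lambda>n. n \<ge> 3 \<and> e n \<le> R \<and> 5 / 4 * e n \<le> 1) sequentially"
  proof (intro eventually_conj)
    have "eventually (\<lambda>n. rate DIM('a) n < R / C) sequentially"
      by (rule rate_eventually_less) (use R C in simp)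
    then show "eventually (\<lambda>n. e n \<le> R) sequentially"
      by eventually_elim (use C in \<open>simp add: e_def field_simps\<close>)
    have "eventually (\<lambda>n. rate DIM('a) n < 4 / 5 / C) sequentially"
      by (rule rate_eventually_less) (use C in simp)
    then show "eventually (\<lambda>n. 5 / 4 * e n \<le> 1) sequentially"
      by eventually_elim (use C in \<open>simp add: e_def field_simps\<close>)
  qed (rule eventually_ge_at_top)
  have e_ge: "4 / real n \<le> e n" if "n \<ge> 3" for n
  proof -
    have "1 / real n \<le> rate DIM('a) n"
      by (rule inverse_le_rate) (use that dim in auto)
    then have "4 * (1 / real n) \<le> C * rate DIM('a) n"
      using C(1) by (intro mult_mono) auto
    then show ?thesis by (simp add: e_def)
  qed
  have "summable (\<lambda>n. prob (Bad n))"
  proof (rule summable_comparison_test_ev)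
    show "summable (\<lambda>n. M * (1 / real n ^ 2))"
      using inverse_power_summable[of 2, where 'a=real]
      by (intro summable_mult) (simp add: inverse_eq_divide)
    show "eventually (\<lambda>n. norm (prob (Bad n)) \<le> M * (1 / real n ^ 2)) sequentially"
      using ev
    proof eventually_elim
      case (elim n)
      then have n: "3 \<le> n" "e n \<le> R" by auto
      have e_pos: "0 < e n"
        by (rule less_le_trans[OF _ e_ge]) (use n in auto)
      have ln0: "0 \<le> ln (real n)" using n by simp
      have missed_le: "prob (missed n y (e n / 4)) \<le> 1 / real n ^ (?d + 2)" if y: "y \<in> N' n" for y
      proof -
        have "e n powr ((real ?d + 1) / 2) = C powr ((real ?d + 1) / 2) * (ln (real n) / real n)"
          using C n rate_powr[of n ?d] by (simp add: e_def powr_mult)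
        \<comment> \<open>As \<open>C \<ge> 1\<close>, the power of \<open>C\<close> may be lowered
          to the linear one that the choice of \<open>C\<close> controls.\<close>
        moreover have "C powr 1 \<le> C powr ((real ?d + 1) / 2)"
          using C dim by (intro powr_mono) auto
        then have "C * (ln (real n) / real n) \<le> C powr ((real ?d + 1) / 2) * (ln (real n) / real n)"
          using C ln0 by (intro mult_right_mono) auto
        ultimately have "C * (ln (real n) / real n) \<le> e n powr ((real ?d + 1) / 2)"
          by simp
        then have "c * (C * (ln (real n) / real n)) \<le> c * e n powr ((real ?d + 1) / 2)"
          by (rule mult_left_mono) (use c in simp)
        also have "\<dots> \<le> intensity y (e n / 4)"
          using y e_pos n by (intro int_ge) (auto simp: N'_def)
        finally have "c * C * ln (real n) \<le> real n * intensity y (e n / 4)"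
          using n by (simp add: field_simps)
        moreover have "real (?d + 2) * ln (real n) \<le> c * C * ln (real n)"
          using C(2) ln0 by (rule mult_right_mono)
        ultimately have "exp (- real n * intensity y (e n / 4)) \<le> exp (- (real (?d + 2) * ln (real n)))"
          by simp
        also have "\<dots> = 1 / real n ^ (?d + 2)" by (rule exp_neg_mult_ln) (use n in simp)
        finally show ?thesis using measure_missed[of "e n / 4" n y] e0[of n] by simp
      qed
      have "prob (Bad n) \<le> (\<Sum>y\<in>N' n. prob (missed n y (e n / 4)))"
        unfolding Bad_def using N' e0[of n]
        by (intro finite_measure_subadditive_finite) (auto intro: sets_missed)
      also have "\<dots> \<le> (\<Sum>y\<in>N' n. 1 / real n ^ (?d + 2))"
        by (intro sum_mono missed_le)
      also have "\<dots> = real (card (N' n)) * (1 / real n ^ (?d + 2))" by simp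
      also have "\<dots> \<le> (M * real n ^ ?d) * (1 / real n ^ (?d + 2))"
      proof (rule mult_right_mono)
        have "real (card (N' n)) \<le> real (card (N n))"
          unfolding N'_def by (intro of_nat_mono card_mono N(1)) auto
        also have "\<dots> \<le> M * real n ^ ?d" by (rule N(2)) (use n in simp)
        finally show "real (card (N' n)) \<le> M * real n ^ ?d" .
      qed simp
      also have "\<dots> = M * (1 / real n ^ 2)"
        using n by (simp add: power_add power2_eq_square)
      finally show ?case by simp
    qed
  qed
  then have "AE \<omega> in P. eventually (\<lambda>n. \<omega> \<in> space P - Bad n) sequentially"
    using Bad_sets by (intro borel_cantelli_AE1) (auto simp: emeasure_eq_measure)
  then have "AE \<omega> in P. eventually (\<lambda>n. \<forall>x\<in>process_cell K \<xi> n \<omega>. infdist x K \<le> 5 / 4 * C * rate DIM('a) n) sequentially"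
  proof eventually_elim
    case (elim \<omega>)
    then show ?case using ev
    proof eventually_elim
      case (elim n)
      then have \<omega>: "\<omega> \<in> space P" "\<omega> \<notin> Bad n" and n: "3 \<le> n" "5 / 4 * e n \<le> 1" by auto
      show ?case
      proof (intro ballI, rule ccontr)
        fix x assume x: "x \<in> process_cell K \<xi> n \<omega>" and "\<not> infdist x K \<le> 5 / 4 * C * rate DIM('a) n"
        then have far: "5 / 4 * e n \<le> infdist x K" by (simp add: e_def)
        obtain k where k: "k \<in> K" using K(3) by blast
        \<comment> \<open>From distance \<open>5 / 4 * e n\<close>, a net point within
          \<open>e n / 4\<close> still has distance at least \<open>e n\<close> and so belongs to
          \<open>N' n\<close>.\<close>
        obtain x' where x': "x' \<in> process_cell K \<xi> n \<omega>" "infdist x' K = 5 / 4 * e n"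
          using convex_exists_infdist_eq[OF convex_process_cell subset_process_cell k x far] e0[of n]
          by auto
        then have "x' \<in> S" using n by (simp add: S_def)
        then obtain y where y: "y \<in> N n" "dist x' y \<le> 1 / real n" using N(3)[of n x'] n by auto
        then have xy: "dist x' y \<le> e n / 4" using e_ge[OF n(1)] by simp
        have "infdist x' K \<le> infdist y K + dist x' y" by (rule infdist_triangle)
        with xy x'(2) have "y \<in> N' n" using y by (simp add: N'_def)
        moreover have "\<omega> \<in> missed n y (e n / 4)"
          using missed_mono[OF _ xy] x'(1) mem_process_cell_iff_missed[OF \<omega>(1)] by blast
        ultimately show False using \<omega>(2) by (auto simp: Bad_def)
      qed
    qed
  qed
  moreover have "0 < 5 / 4 * C" using C by simp
  ultimately show ?thesis using that by blast
qed

section \<open>Lower bound: many independent void events\<close>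

lemma cell_lower_bound:
  obtains c where "0 < c"
    "AE \<omega> in P. eventually (\<lambda>n. \<exists>x\<in>process_cell K \<xi> n \<omega>. c * rate DIM('a) n \<le> infdist x K) sequentially"
proof -
  interpret prob_space P by (rule P)
  let ?d = "DIM('a)"
  obtain x\<^sub>0 r where r: "0 < r" "slides_freely_inside (cball x\<^sub>0 r) K" using inner_ball by blast
  obtain c\<^sub>2 where c\<^sub>2: "0 < c\<^sub>2" and int_le: "\<And>e p v. 0 < e \<Longrightarrow> 2 * e \<le> r \<Longrightarrow> p \<in> K \<Longrightarrow> norm v = 1 \<Longrightarrow>
      cball (p - r *\<^sub>R v) r \<subseteq> K \<Longrightarrow> intensity (p + e *\<^sub>R v) 0 \<le> c\<^sub>2 * e powr ((real ?d + 1) / 2)"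
    using intensity_separating_le[OF \<phi>(1,2) a K(2) r(1)] by blast
  \<comment> \<open>The cap radius \<open>sqrt (e n)\<close> is of order
    \<open>(ln n / n) powr (2 * \<beta>)\<close>, which is negligible against the spacing of about
    \<open>n powr (- \<beta>)\<close> between the normals.\<close>
  define \<beta> where "\<beta> = 1 / (2 * (real ?d + 1))"
  have \<beta>: "0 < \<beta>" by (simp add: \<beta>_def)
  \<comment> \<open>Each candidate then lies in the cell with probability at least
    \<open>n powr (- (\<beta> / 2))\<close>, against at least \<open>n powr \<beta>\<close>
    candidates. \<open>c \<le> 1\<close> gives \<open>c powr ((d + 1) / 2) \<le> c\<close>.\<close>
  define c where "c = min 1 (\<beta> / (2 * c\<^sub>2))"
  have c: "0 < c" "c \<le> 1" "c\<^sub>2 * c \<le> \<beta> / 2"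
  proof -
    have "c \<le> \<beta> / (2 * c\<^sub>2)" by (simp add: c_def)
    then show "c\<^sub>2 * c \<le> \<beta> / 2" using c\<^sub>2 by (simp add: field_simps)
  qed (use \<beta> c\<^sub>2 in \<open>simp_all add: c_def\<close>)
  define e where "e n = c * rate ?d n" for n
  define m where "m n = nat \<lceil>real n powr \<beta>\<rceil>" for n :: nat
  have "\<exists>p\<in>K. \<forall>k\<in>K. k \<bullet> v \<le> p \<bullet> v" for v
    by (rule continuous_attains_sup[OF K(2,3)]) (intro continuous_intros)
  then obtain q where q: "\<And>v. q v \<in> K" "\<And>v k. k \<in> K \<Longrightarrow> k \<bullet> v \<le> q v \<bullet> v" by metis
  have ball: "cball (q v - r *\<^sub>R v) r \<subseteq> K" if "norm v = 1" for v
    by (rule slides_freely_cball_support_point[OF r(2,1) q(1) that q(2)])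
  have "\<not> card (Basis :: 'a set) \<le> Suc 0" using dim by simp
  then obtain b\<^sub>1 b\<^sub>2 :: 'a where basis: "b\<^sub>1 \<in> Basis" "b\<^sub>2 \<in> Basis" "b\<^sub>1 \<noteq> b\<^sub>2"
    unfolding card_le_Suc0_iff_eq[OF finite_Basis] by blast
  \<comment> \<open>normals on a quarter circle, pairwise at distance at least \<open>1 / m n\<close>\<close>
  define w where "w n i = sqrt (1 - (real i / real (m n))\<^sup>2) *\<^sub>R b\<^sub>1 + (real i / real (m n)) *\<^sub>R b\<^sub>2" for n i :: nat
  have w: "norm (w n i) = 1" if "i < m n" for n i
    unfolding w_def using that by (intro unit_arc(1)[OF basis]) simp
  define x where "x n i = q (w n i) + e n *\<^sub>R w n i" for n i
  define A where "A n i = hyperplanes_of (separating K (x n i) 0)" for n i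
  define Bad where "Bad n = {\<omega>\<in>space P. \<forall>i<m n. emeasure (\<xi> \<omega>) ({0..real n} \<times> A n i) \<noteq> 0}" for n
  have Bad_eq: "Bad n = space P - (\<Union>i<m n. missed n (x n i) 0)" for n
    unfolding Bad_def A_def by auto
  have Bad_sets: "Bad n \<in> sets P" for n
    unfolding Bad_eq by (intro sets.Diff sets.top sets.finite_UN) (auto intro: sets_missed)
  have ev: "eventually (\<lambda>n. n \<ge> 2 \<and> 2 * e n \<le> r \<and> 2 * sqrt (2 * e n / r) < 1 / real (m n)) sequentially"
  proof (intro eventually_conj)
    have "eventually (\<lambda>n. rate ?d n < r / (2 * c)) sequentially"
      by (rule rate_eventually_less) (use r c in simp)
    then show "eventually (\<lambda>n. 2 * e n \<le> r) sequentially"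
      by eventually_elim (use c in \<open>simp add: e_def field_simps\<close>)
    have "eventually (\<lambda>n::nat. (real n powr \<beta> + 1) * (ln (real n) / real n) powr (2 * \<beta>) <
        1 / (2 * sqrt (2 * c / r))) sequentially"
      by (intro order_tendstoD(2)[OF rate_times_tendsto_0[OF \<beta>]]) (use r c in simp)
    with eventually_ge_at_top[of 1]
    show "eventually (\<lambda>n. 2 * sqrt (2 * e n / r) < 1 / real (m n)) sequentially"
    proof eventually_elim
      case (elim n)
      have "0 < real n powr \<beta>" using elim by simp
      then have m: "0 < real (m n)" "real (m n) \<le> real n powr \<beta> + 1"
        unfolding m_def by linarith+
      have "sqrt (rate ?d n) = (rate ?d n) powr (1 / 2)"
        by (rule powr_half_sqrt[symmetric]) simp
      also have "\<dots> = (ln (real n) / real n) powr (2 / (real ?d + 1) * (1 / 2))"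
        by (rule powr_powr)
      also have "2 / (real ?d + 1) * (1 / 2) = 2 * \<beta>"
        by (simp add: \<beta>_def field_simps)
      finally have sq: "sqrt (2 * e n / r) = sqrt (2 * c / r) * (ln (real n) / real n) powr (2 * \<beta>)"
        by (simp add: e_def real_sqrt_mult real_sqrt_divide)
      have "real (m n) * (ln (real n) / real n) powr (2 * \<beta>) \<le>
          (real n powr \<beta> + 1) * (ln (real n) / real n) powr (2 * \<beta>)"
        using m by (intro mult_right_mono) auto
      also have "\<dots> < 1 / (2 * sqrt (2 * c / r))" using elim by simp
      finally have "2 * (sqrt (2 * c / r) * (ln (real n) / real n) powr (2 * \<beta>)) * real (m n) < 1"
        using r c by (simp add: pos_less_divide_eq mult_ac)
      then show ?case unfolding sq using m by (simp add: pos_less_divide_eq)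
    qed
  qed (rule eventually_ge_at_top)
  have "summable (\<lambda>n. prob (Bad n))"
  proof (rule summable_comparison_test_ev)
    show "summable (\<lambda>n::nat. exp (- (real n powr (\<beta> / 2))))"
      by (rule summable_exp_neg_powr) (use \<beta> in simp)
    show "eventually (\<lambda>n. norm (prob (Bad n)) \<le> exp (- (real n powr (\<beta> / 2)))) sequentially"
      using ev
    proof eventually_elim
      case (elim n)
      then have n: "2 \<le> n" "2 * e n \<le> r" "2 * sqrt (2 * e n / r) < 1 / real (m n)" by auto
      have e_pos: "0 < e n" using n c by (simp add: e_def)
      have ln0: "0 \<le> ln (real n)" using n by simp
      have "0 < real n powr \<beta>" using n by simp
      then have m: "0 < m n" "real n powr \<beta> \<le> real (m n)"
        unfolding m_def by linarith+
      have A: "A n i \<in> sets hyperplane_borel" "emeasure (hyperplane_intensity \<phi> 1) (A n i) < \<infinity>" for i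
        unfolding A_def by (intro sets_hyperplanes_of open_separating K(2))
          (rule intensity_separating_finite[OF \<phi>(1,2) q(1)], simp)
      have disj: "disjoint_family_on (A n) {..<m n}"
        unfolding disjoint_family_on_def
      proof (intro ballI impI)
        fix i j assume ij: "i \<in> {..<m n}" "j \<in> {..<m n}" "i \<noteq> j"
        have "1 \<le> \<bar>real i - real j\<bar>" using ij(3) by linarith
        then have "1 / real (m n) \<le> \<bar>real i / real (m n) - real j / real (m n)\<bar>"
          using m by (simp add: divide_right_mono flip: diff_divide_distrib)
        also have "\<dots> \<le> norm (w n i - w n j)"
          unfolding w_def by (rule unit_arc(2)[OF basis]) (use ij in simp)
        finally have "2 * sqrt (2 * e n / r) < norm (w n i - w n j)" using n(3) by linarith
        then show "A n i \<inter> A n j = {}"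
          unfolding A_def x_def using ij
          by (intro disjoint_hyperplanes_of_separating[OF r(1) e_pos q(1) q(1)] w ball) auto
      qed
      have factor: "1 - exp (- real n * measure (hyperplane_intensity \<phi> 1) (A n i)) \<le> exp (- (real n powr (- (\<beta> / 2))))"
        if i: "i < m n" for i
      proof -
        have "measure (hyperplane_intensity \<phi> 1) (A n i) \<le> c\<^sub>2 * e n powr ((real ?d + 1) / 2)"
          unfolding A_def x_def by (rule int_le[OF e_pos n(2) q(1) w[OF i] ball[OF w[OF i]]])
        also have "e n powr ((real ?d + 1) / 2) = c powr ((real ?d + 1) / 2) * (ln (real n) / real n)"
          using c n rate_powr[of n ?d] by (simp add: e_def powr_mult)
        also have "c\<^sub>2 * \<dots> \<le> c\<^sub>2 * (c powr 1 * (ln (real n) / real n))"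
          using c\<^sub>2 c ln0 dim by (intro mult_left_mono mult_right_mono powr_mono') auto
        also have "\<dots> = (c\<^sub>2 * c) * ln (real n) / real n" using c by simp
        also have "\<dots> \<le> \<beta> / 2 * ln (real n) / real n"
          using c(3) ln0 by (intro divide_right_mono mult_right_mono) auto
        finally have "real n * measure (hyperplane_intensity \<phi> 1) (A n i) \<le> \<beta> / 2 * ln (real n)"
          using n by (simp add: field_simps)
        then have "exp (- (\<beta> / 2) * ln (real n)) \<le> exp (- real n * measure (hyperplane_intensity \<phi> 1) (A n i))"
          by simp
        then have "1 - exp (- real n * measure (hyperplane_intensity \<phi> 1) (A n i)) \<le> 1 + - (real n powr (- (\<beta> / 2)))"
          using n by (simp add: powr_def)
        \<comment> \<open>In exponential form the product over the \<open>m n\<close> candidates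
          becomes a sum in the exponent, at least \<open>n powr (\<beta> / 2)\<close> in
          size.\<close>
        also have "\<dots> \<le> exp (- (real n powr (- (\<beta> / 2))))" by (rule exp_ge_add_one_self)
        finally show ?thesis .
      qed
      have "prob (Bad n) = (\<Prod>i<m n. 1 - exp (- real n * measure (hyperplane_intensity \<phi> 1) (A n i)))"
        unfolding Bad_def by (rule no_void_probability[OF \<phi>(1,2) P \<xi> A disj m(1)])
      also have "\<dots> \<le> (\<Prod>i<m n. exp (- (real n powr (- (\<beta> / 2)))))"
      proof (intro prod_mono conjI)
        fix i assume "i \<in> {..<m n}"
        then show "1 - exp (- real n * measure (hyperplane_intensity \<phi> 1) (A n i)) \<le> exp (- (real n powr (- (\<beta> / 2))))"
          by (intro factor) simp
      qed simp
      also have "\<dots> = exp (- (real (m n) * real n powr (- (\<beta> / 2))))"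
        by (simp add: exp_of_nat_mult[symmetric])
      also have "\<dots> \<le> exp (- (real n powr \<beta> * real n powr (- (\<beta> / 2))))"
        using m by (simp add: mult_right_mono)
      also have "real n powr \<beta> * real n powr (- (\<beta> / 2)) = real n powr (\<beta> / 2)"
        by (simp flip: powr_add)
      finally show ?case by simp
    qed
  qed
  then have "AE \<omega> in P. eventually (\<lambda>n. \<omega> \<in> space P - Bad n) sequentially"
    using Bad_sets by (intro borel_cantelli_AE1) (auto simp: emeasure_eq_measure)
  then have "AE \<omega> in P. eventually (\<lambda>n. \<exists>x\<in>process_cell K \<xi> n \<omega>. c * rate ?d n \<le> infdist x K) sequentially"
  proof eventually_elim
    case (elim \<omega>)
    then show ?case
    proof eventually_elim
      case (elim n)
      then have \<omega>: "\<omega> \<in> space P" and "\<omega> \<in> (\<Union>i<m n. missed n (x n i) 0)"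
        by (auto simp: Bad_eq)
      then obtain i where i: "i < m n" "\<omega> \<in> missed n (x n i) 0" by blast
      have "x n i \<in> process_cell K \<xi> n \<omega>"
        unfolding mem_process_cell_iff_missed[OF \<omega>] by (rule i(2))
      moreover have "e n \<le> infdist (x n i) K"
        unfolding x_def by (rule infdist_add_normal[OF q(1) w[OF i(1)] q(2)])
      ultimately show ?case unfolding e_def by blast
    qed
  qed
  with c(1) show ?thesis by (rule that)
qed

lemma hausdorff_distance_cell_order:
  "almost_surely_of_order P (\<lambda>n \<omega>. hausdorff_distance K (process_cell K \<xi> n \<omega>)) (rate DIM('a))"
proof -
  obtain C where C: "0 < C" and upper:
    "AE \<omega> in P. eventually (\<lambda>n. \<forall>x\<in>process_cell K \<xi> n \<omega>. infdist x K \<le> C * rate DIM('a) n) sequentially"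
    by (rule cell_upper_bound)
  obtain c where c: "0 < c" and lower:
    "AE \<omega> in P. eventually (\<lambda>n. \<exists>x\<in>process_cell K \<xi> n \<omega>. c * rate DIM('a) n \<le> infdist x K) sequentially"
    by (rule cell_lower_bound)
  \<comment> \<open>\<open>min c C\<close> provides the ordering of the two constants that
    \<open>almost_surely_of_order\<close> demands.\<close>
  have "AE \<omega> in P. eventually (\<lambda>n.
      min c C * rate DIM('a) n \<le> hausdorff_distance K (process_cell K \<xi> n \<omega>) \<and>
      hausdorff_distance K (process_cell K \<xi> n \<omega>) \<le> C * rate DIM('a) n) sequentially"
    using upper lower
  proof eventually_elim
    case (elim \<omega>)
    then show ?case
    proof eventually_elim
      case (elim n)
      let ?Z = "process_cell K \<xi> n \<omega>"
      obtain x where x: "x \<in> ?Z" "c * rate DIM('a) n \<le> infdist x K" by (rule bexE[OF elim(2)])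
      have "infdist k ?Z = 0" if "k \<in> K" for k
        by (rule infdist_zero) (rule subsetD[OF subset_process_cell that])
      then have "(SUP k\<in>K. infdist k ?Z) = 0" using K(3) by simp
      moreover have "(SUP z\<in>?Z. infdist z K) \<le> C * rate DIM('a) n"
        using x(1) elim(1) by (intro cSUP_least) auto
      \<comment> \<open>A real supremum dominates its terms only over a bounded family; the upper
        estimate supplies that bound.\<close>
      moreover have "infdist x K \<le> (SUP z\<in>?Z. infdist z K)"
        using x(1) elim(1) by (intro cSUP_upper bdd_aboveI2) auto
      moreover have "min c C * rate DIM('a) n \<le> c * rate DIM('a) n"
        by (rule mult_right_mono) auto
      moreover have "0 \<le> infdist x K" by (rule infdist_nonneg)
      ultimately show ?case
        unfolding hausdorff_distance_def using x(2) by simp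
    qed
  qed
  moreover have "0 < min c C" "min c C \<le> C" using c C by auto
  ultimately show ?thesis unfolding almost_surely_of_order_def by blast
qed

end

theorem theorem3:
  fixes K :: "'a::euclidean_space set"
    and \<phi> :: "'a measure"
    and a b :: real
    and P :: "'w measure"
    and \<xi> :: "'w \<Rightarrow> (real \<times> 'a set) measure"
  assumes "DIM('a) \<ge> 2"
    and "convex_body K"
    and "\<exists>x r. r > 0 \<and> slides_freely_inside (cball x r) K"
    and "\<exists>x R. R > 0 \<and> slides_freely_inside K (cball x R)"
    and "sets \<phi> = sets sphere_borel" and "prob_space \<phi>" and "even_measure \<phi>"
    and "a > 0" and "b > 0"
    and "\<forall>A\<in>sets \<phi>. ennreal a * emeasure sphere_lebesgue A \<ge> emeasure \<phi> A \<and>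
           emeasure \<phi> A \<ge> ennreal b * emeasure sphere_lebesgue A"
    and "prob_space P"
    and "poisson_hyperplane_driver P \<phi> \<xi>"
  shows "almost_surely_of_order P
           (\<lambda>n \<omega>. hausdorff_distance K (process_cell K \<xi> n \<omega>))
           (\<lambda>n. (ln (real n) / real n) powr (2 / (real DIM('a) + 1)))"
proof -
  interpret poisson_K_cell K \<phi> a b P \<xi>
    using assms by (intro poisson_K_cell.intro) (auto simp: convex_body_def)
  show ?thesis by (rule hausdorff_distance_cell_order)
qed

end
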